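(* Let $k$ be a field, let $p,q\in\mathbb Z^+$ be relatively prime, and let $\{L_n\}_{n\in\mathbb N}$ be the $(p,q)$-Lucas sequence. Let $a,d\in\mathbb Z^+$ and $n\ge 3$, and let $\mathcal A=\{d_1,\ldots,d_n\}$ with $d_i:=L_{a+(i-1)d}$ for all $i\in\{1,\ldots,n\}$. Then $I_{\mathcal A}$ is a complete intersection if and only if one of the following holds: (a) $d$ is odd; (b) $d\ge a$; (c) $\gcd\{a,d\}=a-d$ and $[d]_2>[a]_2\ge 1$; (d) $n=3$, $p$ and $a/d$ are odd and $q$ is even; or (e) $n=3$, $3\nmid d$, and $p$, $q$ and $a/d$ are odd.
   Context: $\mathbb N$ denotes the nonnegative integers and $\mathbb Z^+$ the positive integers. The $(p,q)$-Lucas sequence is defined by $L_0=2$, $L_1=p$, $L_{n+2}=pL_{n+1}+qL_n$ for all $n\ge 0$. For $m\in\mathbb Z^+$, $[m]_2:=\max\{t\in\mathbb N : 2^t\mid m\}$ is the $2$-valuation. "$a/d$ is odd" means that $d$ divides $a$ and the quotient is an odd integer. For $\mathcal A=\{d_1,\ldots,d_n\}\subset\mathbb Z^+$, the toric ideal $I_{\mathcal A}$ is the kernel of the $k$-algebra homomorphism $k[x_1,\ldots,x_n]\to k[t]$, $x_i\mapsto t^{d_i}$. It has height $n-1$; it is a complete intersection if its minimal number of generators equals $n-1$. *)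

theory Defs
  imports
    "HOL-Library.Poly_Mapping"
    "HOL-Library.Extended_Nat"
    "HOL-Computational_Algebra.Polynomial"
    "HOL-Algebra.RingHom"
begin

fun lucas :: "nat \<Rightarrow> nat \<Rightarrow> nat \<Rightarrow> nat" where
  "lucas p q 0 = 2"
| "lucas p q (Suc 0) = p"
| "lucas p q (Suc (Suc n)) = p * lucas p q (Suc n) + q * lucas p q n"

(* A monomial is its finitely supported exponent vector; a polynomial is a finitely supported
   family of coefficients on monomials, multiplied by convolution.  The type has variables
   indexed by all of nat, and mpoly_ring n is the subring k[x_1, ..., x_n]. *)
type_synonym 'k mpoly = "(nat \<Rightarrow>\<^sub>0 nat) \<Rightarrow>\<^sub>0 'k"

definition mpoly_ring :: "nat \<Rightarrow> 'k::field mpoly ring" where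
  "mpoly_ring n =
    \<lparr> carrier = {P. \<forall>m \<in> Poly_Mapping.keys P. Poly_Mapping.keys m \<subseteq> {1..n}},
      monoid.mult = (*), one = 1, ring.zero = 0, add = (+) \<rparr>"

definition upoly_ring :: "'k::field poly ring" where
  "upoly_ring = \<lparr> carrier = UNIV, monoid.mult = (*), one = 1, ring.zero = 0, add = (+) \<rparr>"

(* Substitution of t^(d i) for x_i. *)
definition toric_hom :: "(nat \<Rightarrow> nat) \<Rightarrow> 'k::field mpoly \<Rightarrow> 'k poly" where
  "toric_hom d P =
    (\<Sum>m \<in> Poly_Mapping.keys P. smult (Poly_Mapping.lookup P m)
      (\<Prod>i \<in> Poly_Mapping.keys m. Polynomial.monom 1 (d i) ^ Poly_Mapping.lookup m i))"

definition toric_ideal :: "nat \<Rightarrow> (nat \<Rightarrow> nat) \<Rightarrow> 'k::field mpoly set" where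
  "toric_ideal n d = a_kernel (mpoly_ring n) upoly_ring (toric_hom d)"

(* The infimum is \<infinity> when no finite generating set exists. *)
definition min_num_generators :: "('a, 'b) ring_scheme \<Rightarrow> 'a set \<Rightarrow> enat" where
  "min_num_generators R I =
    (INF S \<in> {S. finite S \<and> S \<subseteq> carrier R \<and> genideal R S = I}. enat (card S))"

(* To be used for I a toric ideal of n positive integers, whose height is n - 1: k[t] is integral
   over the image of toric_hom, which therefore has dimension 1. *)
definition toric_complete_intersection :: "nat \<Rightarrow> 'k::field mpoly set \<Rightarrow> bool" where
  "toric_complete_intersection n I \<longleftrightarrow> min_num_generators (mpoly_ring n) I = enat (n - 1)"

lemma mpoly_ring_cring: "cring (mpoly_ring n :: 'k::field mpoly ring)"
proof (rule cringI)
  have uminus: "- P \<in> carrier (mpoly_ring n)" if "P \<in> carrier (mpoly_ring n)" for P :: "'k mpoly"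
    using that by (auto simp: mpoly_ring_def in_keys_iff)
  have add: "P + Q \<in> carrier (mpoly_ring n)"
    if "P \<in> carrier (mpoly_ring n)" "Q \<in> carrier (mpoly_ring n)" for P Q :: "'k mpoly"
    using that Poly_Mapping.keys_add[of P Q] by (auto simp: mpoly_ring_def)
  have mult: "P * Q \<in> carrier (mpoly_ring n)"
    if PQ: "P \<in> carrier (mpoly_ring n)" "Q \<in> carrier (mpoly_ring n)" for P Q :: "'k mpoly"
  proof -
    have "Poly_Mapping.keys m \<subseteq> {1..n}" if m: "m \<in> Poly_Mapping.keys (P * Q)" for m
    proof -
      obtain a b where ab: "m = a + b" "a \<in> Poly_Mapping.keys P" "b \<in> Poly_Mapping.keys Q"
        using keys_mult[of P Q] m by auto
      then have "Poly_Mapping.keys a \<subseteq> {1..n}" "Poly_Mapping.keys b \<subseteq> {1..n}"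
        using PQ by (auto simp: mpoly_ring_def)
      then show ?thesis
        using Poly_Mapping.keys_add[of a b] ab(1) by blast
    qed
    then show ?thesis by (simp add: mpoly_ring_def)
  qed
  have zero_one: "0 \<in> carrier (mpoly_ring n :: 'k mpoly ring)"
    "1 \<in> carrier (mpoly_ring n :: 'k mpoly ring)"
    by (simp_all add: mpoly_ring_def)
  have ops: "\<zero>\<^bsub>mpoly_ring n\<^esub> = (0 :: 'k mpoly)" "\<one>\<^bsub>mpoly_ring n\<^esub> = (1 :: 'k mpoly)"
    "P \<oplus>\<^bsub>mpoly_ring n\<^esub> Q = P + Q" "P \<otimes>\<^bsub>mpoly_ring n\<^esub> Q = P * Q" for P Q :: "'k mpoly"
    by (simp_all add: mpoly_ring_def)
  show "abelian_group (mpoly_ring n :: 'k mpoly ring)"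
  proof (rule abelian_groupI)
    show "\<exists>Q \<in> carrier (mpoly_ring n). Q \<oplus>\<^bsub>mpoly_ring n\<^esub> P = \<zero>\<^bsub>mpoly_ring n\<^esub>"
      if "P \<in> carrier (mpoly_ring n)" for P :: "'k mpoly"
      using uminus[OF that] by (intro bexI[of _ "- P"]) (simp_all add: ops)
  qed (simp_all add: ops zero_one add ac_simps)
  show "comm_monoid (mpoly_ring n :: 'k mpoly ring)"
    by (rule comm_monoidI) (simp_all add: ops zero_one mult ac_simps)
  show "(P \<oplus>\<^bsub>mpoly_ring n\<^esub> Q) \<otimes>\<^bsub>mpoly_ring n\<^esub> R =
      P \<otimes>\<^bsub>mpoly_ring n\<^esub> R \<oplus>\<^bsub>mpoly_ring n\<^esub> Q \<otimes>\<^bsub>mpoly_ring n\<^esub> R" for P Q R :: "'k mpoly"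
    by (simp add: ops distrib_right)
qed

lemma upoly_ring_cring: "cring (upoly_ring :: 'k::field poly ring)"
proof (rule cringI)
  show "abelian_group (upoly_ring :: 'k poly ring)"
  proof (rule abelian_groupI)
    show "\<exists>Q \<in> carrier upoly_ring. Q \<oplus>\<^bsub>upoly_ring\<^esub> P = \<zero>\<^bsub>upoly_ring\<^esub>" for P :: "'k poly"
      by (intro bexI[of _ "- P"]) (simp_all add: upoly_ring_def)
  qed (auto simp: upoly_ring_def algebra_simps)
  show "comm_monoid (upoly_ring :: 'k poly ring)"
    by (rule comm_monoidI) (auto simp: upoly_ring_def algebra_simps)
qed (auto simp: upoly_ring_def algebra_simps)

lemma toric_hom_alt:
  "toric_hom d P =
    (\<Sum>m \<in> Poly_Mapping.keys P. Polynomial.monom (Poly_Mapping.lookup P m)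
      (\<Sum>i \<in> Poly_Mapping.keys m. Poly_Mapping.lookup m i * d i))"
proof -
  have "(\<Prod>i \<in> A. Polynomial.monom (1 :: 'a) (d i) ^ Poly_Mapping.lookup m i)
      = Polynomial.monom 1 (\<Sum>i \<in> A. Poly_Mapping.lookup m i * d i)" for A m
    by (induction A rule: infinite_finite_induct)
      (simp_all add: monom_power mult_monom mult.commute)
  then show ?thesis
    by (simp add: toric_hom_def smult_monom)
qed

lemma toric_hom_single:
  "toric_hom d (Poly_Mapping.single m c) =
    Polynomial.monom c (\<Sum>i \<in> Poly_Mapping.keys m. Poly_Mapping.lookup m i * d i)"
  by (simp add: toric_hom_alt)

lemma toric_hom_const: "toric_hom d (Poly_Mapping.single 0 c) = [:c:]"
  by (simp add: toric_hom_single monom_0)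

lemma toric_hom_var:
  "toric_hom d (Poly_Mapping.single (Poly_Mapping.single i 1) 1) = Polynomial.monom 1 (d i)"
  by (simp add: toric_hom_single)

lemma toric_hom_zero: "toric_hom d 0 = 0"
  by (simp add: toric_hom_alt)

lemma toric_hom_add: "toric_hom d (P + Q) = toric_hom d P + toric_hom d Q"
  unfolding toric_hom_alt by (rule setsum_keys_plus_distrib) (simp_all add: add_monom)

lemma toric_hom_sum: "toric_hom d (sum f A) = (\<Sum>x \<in> A. toric_hom d (f x))"
  by (induction A rule: infinite_finite_induct) (simp_all add: toric_hom_zero toric_hom_add)

lemma toric_hom_mult: "toric_hom d (P * Q) = toric_hom d P * toric_hom d Q"
proof -
  have expand: "R = (\<Sum>m \<in> Poly_Mapping.keys R. Poly_Mapping.single m (Poly_Mapping.lookup R m))"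
    for R :: "'a mpoly"
    by (rule poly_mapping_eqI)
      (simp add: lookup_sum lookup_single when_def in_keys_iff)
  have exps: "(\<Sum>i \<in> Poly_Mapping.keys (a + b). Poly_Mapping.lookup (a + b) i * d i) =
      (\<Sum>i \<in> Poly_Mapping.keys a. Poly_Mapping.lookup a i * d i) +
      (\<Sum>i \<in> Poly_Mapping.keys b. Poly_Mapping.lookup b i * d i)" for a b
    by (rule setsum_keys_plus_distrib) (simp_all add: algebra_simps)
  have "toric_hom d (P * Q) =
      toric_hom d ((\<Sum>a \<in> Poly_Mapping.keys P. Poly_Mapping.single a (Poly_Mapping.lookup P a)) *
        (\<Sum>b \<in> Poly_Mapping.keys Q. Poly_Mapping.single b (Poly_Mapping.lookup Q b)))"
    by (rule arg_cong2[where f = "\<lambda>x y. toric_hom d (x * y)", OF expand expand])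
  also have "\<dots> = toric_hom d P * toric_hom d Q"
    by (simp add: sum_product toric_hom_sum mult_single toric_hom_single exps
        toric_hom_alt[of d P] toric_hom_alt[of d Q] mult_monom)
  finally show ?thesis .
qed

lemma toric_hom_ring_hom: "toric_hom d \<in> ring_hom (mpoly_ring n) upoly_ring"
proof (rule ring_hom_memI)
  have "toric_hom d 1 = 1"
    using toric_hom_const[of d 1] by (simp add: one_pCons)
  then show "toric_hom d \<one>\<^bsub>mpoly_ring n\<^esub> = \<one>\<^bsub>upoly_ring\<^esub>"
    by (simp add: mpoly_ring_def upoly_ring_def)
qed (simp_all add: mpoly_ring_def upoly_ring_def toric_hom_add toric_hom_mult)

lemma toric_ideal_ideal: "ideal (toric_ideal n d) (mpoly_ring n)"
proof -
  interpret ring_hom_ring "mpoly_ring n" upoly_ring "toric_hom d"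
    by (intro ring_hom_ringI2 cring.axioms(1) mpoly_ring_cring upoly_ring_cring toric_hom_ring_hom)
  show ?thesis
    unfolding toric_ideal_def by (rule kernel_is_ideal)
qed

end

theory Submission
  imports Defs "HOL-Number_Theory.Cong"
begin

text \<open>
  Write \<open>D i = L (a + (i - 1) * d)\<close>.  Everything on the Lucas side follows from
  \<open>L (m + 2 * k) = L k * L (m + k) - (- q) ^ k * L m\<close>: it relates three consecutive \<open>D i\<close>,
  and it computes \<open>gcd (L m) (L n)\<close> by a Euclidean algorithm.

  In cases (a), (b) and (c) all \<open>D i\<close> lie in the semigroup generated by \<open>D 1\<close> and \<open>D 2\<close>: for odd
  \<open>d\<close> by the recurrence, otherwise because \<open>D 1 * D 2 \<le> gcd (D 1) (D 2) * D i\<close>.  In cases (d) and (e)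
  the ideal is a gluing, since \<open>L d\<close> divides \<open>D 1\<close> and \<open>D 3\<close>, is coprime to \<open>D 2\<close>, and
  \<open>L d * D 2 = q ^ d * D 1 + D 3\<close>.

  Conversely, let \<open>m i\<close> be the least positive integer such that \<open>m i * D i\<close> is a combination of the
  other \<open>D j\<close>.  Distinct degrees \<open>m i * D i\<close> would give \<open>n\<close> minimal generators, so a complete
  intersection has \<open>m i * D i = m j * D j\<close> for some \<open>i < j\<close>, and then
  \<open>D j \<le> m i * gcd (D i) (D j)\<close>.  This contradicts \<open>m i \<le> L d\<close> for \<open>1 < i < n\<close> and
  \<open>m 1 * gcd (D 1) (D 2) < D 2\<close>.
\<close>

section \<open>Weighted degrees and expansions of polynomials into monomials\<close>

text \<open>The exponent of \<open>t\<close> in the image of the monomial \<open>m\<close> under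
  \<open>toric_hom d\<close>.\<close>

definition wdeg :: "(nat \<Rightarrow> nat) \<Rightarrow> (nat \<Rightarrow>\<^sub>0 nat) \<Rightarrow> nat" where
  "wdeg d m = (\<Sum>i \<in> Poly_Mapping.keys m. Poly_Mapping.lookup m i * d i)"

abbreviation xpow :: "(nat \<Rightarrow>\<^sub>0 nat) \<Rightarrow> 'k::field mpoly" where
  "xpow u \<equiv> Poly_Mapping.single u 1"

lemma wdeg_add: "wdeg d (u + v) = wdeg d u + wdeg d v"
  unfolding wdeg_def by (rule setsum_keys_plus_distrib) (simp_all add: algebra_simps)

lemma wdeg_single [simp]: "wdeg d (Poly_Mapping.single i k) = k * d i"
  by (simp add: wdeg_def)

lemma wdeg_eq_sum:
  assumes "finite A" "Poly_Mapping.keys m \<subseteq> A"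
  shows "wdeg d m = (\<Sum>i \<in> A. Poly_Mapping.lookup m i * d i)"
  unfolding wdeg_def using assms
  by (intro sum.mono_neutral_left) (auto simp: in_keys_iff)

lemma poly_mapping_expand:
  "(\<Sum>m \<in> Poly_Mapping.keys f. Poly_Mapping.single m (Poly_Mapping.lookup f m)) = f"
  by (rule poly_mapping_eqI) (simp add: lookup_sum lookup_single when_def in_keys_iff)

lemma poly_mapping_expand_superset:
  assumes "finite A" "Poly_Mapping.keys f \<subseteq> A"
  shows "(\<Sum>m \<in> A. Poly_Mapping.single m (Poly_Mapping.lookup f m)) = f"
  by (rule poly_mapping_eqI)
    (use assms in \<open>auto simp: lookup_sum lookup_single when_def in_keys_iff\<close>)

lemma single_mult_eq_sum:
  fixes f :: "'k::field mpoly"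
  shows "Poly_Mapping.single w c * f =
    (\<Sum>m \<in> Poly_Mapping.keys f. Poly_Mapping.single (w + m) (c * Poly_Mapping.lookup f m))"
proof -
  have "Poly_Mapping.single w c * f =
      Poly_Mapping.single w c * (\<Sum>m \<in> Poly_Mapping.keys f. Poly_Mapping.single m (Poly_Mapping.lookup f m))"
    by (simp only: poly_mapping_expand)
  then show ?thesis by (simp add: sum_distrib_left mult_single)
qed

lemma additive_sum:
  fixes \<phi> :: "'a::ab_group_add \<Rightarrow> 'b::ab_group_add"
  assumes "\<And>f g. \<phi> (f + g) = \<phi> f + \<phi> g"
  shows "\<phi> (sum h A) = (\<Sum>x \<in> A. \<phi> (h x))"
proof -
  have "\<phi> 0 = 0" using assms[of 0 0] by simp
  then show ?thesis by (induction A rule: infinite_finite_induct) (simp_all add: assms)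
qed

subsection \<open>Ideals of the polynomial ring\<close>

lemma mpoly_ring_simps [simp]:
  "\<zero>\<^bsub>mpoly_ring n\<^esub> = 0" "\<one>\<^bsub>mpoly_ring n\<^esub> = 1"
  "P \<oplus>\<^bsub>mpoly_ring n\<^esub> Q = P + Q" "P \<otimes>\<^bsub>mpoly_ring n\<^esub> Q = P * Q"
  by (simp_all add: mpoly_ring_def)

lemma mem_carrier_mpoly_ring:
  "P \<in> carrier (mpoly_ring n) \<longleftrightarrow> (\<forall>m \<in> Poly_Mapping.keys P. Poly_Mapping.keys m \<subseteq> {1..n})"
  by (simp add: mpoly_ring_def)

lemma single_mem_carrier:
  "Poly_Mapping.keys w \<subseteq> {1..n} \<Longrightarrow> Poly_Mapping.single w c \<in> carrier (mpoly_ring n)"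
  by (auto simp: mem_carrier_mpoly_ring)

lemma uminus_mem_carrier: "P \<in> carrier (mpoly_ring n) \<Longrightarrow> - P \<in> carrier (mpoly_ring n)"
  by (auto simp: mem_carrier_mpoly_ring in_keys_iff)

lemma a_inv_mpoly_ring:
  assumes "P \<in> carrier (mpoly_ring n)"
  shows "\<ominus>\<^bsub>mpoly_ring n\<^esub> P = - P"
proof -
  interpret cring "mpoly_ring n" by (rule mpoly_ring_cring)
  show ?thesis
    by (rule minus_equality) (use assms in \<open>simp_all add: uminus_mem_carrier\<close>)
qed

context
  fixes J :: "'k::field mpoly set" and n :: nat
  assumes J: "ideal J (mpoly_ring n)"
begin

interpretation J: ideal J "mpoly_ring n" by (rule J)

lemma ideal_zero: "0 \<in> J"
  using additive_subgroup.zero_closed[OF J.is_additive_subgroup] by simp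

lemma ideal_add: "P \<in> J \<Longrightarrow> Q \<in> J \<Longrightarrow> P + Q \<in> J"
  using additive_subgroup.a_closed[OF J.is_additive_subgroup] by simp

lemma ideal_mult: "P \<in> J \<Longrightarrow> R \<in> carrier (mpoly_ring n) \<Longrightarrow> R * P \<in> J"
  using J.I_l_closed by simp

lemma ideal_uminus: "P \<in> J \<Longrightarrow> - P \<in> J"
  using ideal_mult[of P "- 1"] uminus_mem_carrier[OF J.one_closed] by simp

lemma ideal_sum: "(\<And>x. x \<in> A \<Longrightarrow> h x \<in> J) \<Longrightarrow> sum h A \<in> J"
  by (induction A rule: infinite_finite_induct) (simp_all add: ideal_zero ideal_add)

text \<open>By additivity, closure under multiplication has to be checked only for terms
  \<open>Poly_Mapping.single w c\<close>: any other multiplier is the sum of its terms.\<close>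

lemma ideal_of_functional:
  fixes \<phi> :: "'k mpoly \<Rightarrow> 'k"
  assumes add: "\<And>f g. \<phi> (f + g) = \<phi> f + \<phi> g"
    and mult: "\<And>w c f. f \<in> J \<Longrightarrow> \<phi> f = 0 \<Longrightarrow> \<phi> (Poly_Mapping.single w c * f) = 0"
  shows "ideal {f \<in> J. \<phi> f = 0} (mpoly_ring n)"
proof -
  have zero: "\<phi> 0 = 0" using add[of 0 0] by (simp only: add_0_left add_cancel_right_right)
  have minus: "\<phi> (- f) = - \<phi> f" for f
    using add[of f "- f"] zero by (simp add: add_eq_0_iff)
  have prod: "\<phi> (g * f) = 0" if "f \<in> J" "\<phi> f = 0" for f g
  proof -
    have "g * f = (\<Sum>m \<in> Poly_Mapping.keys g. Poly_Mapping.single m (Poly_Mapping.lookup g m) * f)"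
      by (simp only: sum_distrib_right[symmetric] poly_mapping_expand)
    then show ?thesis using that by (simp add: additive_sum[of \<phi>, OF add] mult)
  qed
  show ?thesis
  proof (rule idealI)
    show "ring (mpoly_ring n)" by (rule cring.axioms(1)[OF mpoly_ring_cring])
    show "subgroup {f \<in> J. \<phi> f = 0} (add_monoid (mpoly_ring n))"
    proof
      show "{f \<in> J. \<phi> f = 0} \<subseteq> carrier (add_monoid (mpoly_ring n))"
        using J.a_subset by auto
    next
      fix f assume f: "f \<in> {f \<in> J. \<phi> f = 0}"
      then have "\<ominus>\<^bsub>mpoly_ring n\<^esub> f = - f" using J.a_subset by (auto intro: a_inv_mpoly_ring)
      then have "inv\<^bsub>add_monoid (mpoly_ring n)\<^esub> f = - f" unfolding a_inv_def .
      moreover have "- f \<in> {f \<in> J. \<phi> f = 0}" using f by (simp add: ideal_uminus minus)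
      ultimately show "inv\<^bsub>add_monoid (mpoly_ring n)\<^esub> f \<in> {f \<in> J. \<phi> f = 0}" by (simp only:)
    qed (auto simp: add zero ideal_zero ideal_add)
  next
    fix f g :: "'k mpoly"
    assume "f \<in> {f \<in> J. \<phi> f = 0}" "g \<in> carrier (mpoly_ring n)"
    then have "g * f \<in> {f \<in> J. \<phi> f = 0}" by (simp add: prod ideal_mult)
    then show "g \<otimes>\<^bsub>mpoly_ring n\<^esub> f \<in> {f \<in> J. \<phi> f = 0}"
      "f \<otimes>\<^bsub>mpoly_ring n\<^esub> g \<in> {f \<in> J. \<phi> f = 0}"
      by (simp_all only: mpoly_ring_simps mult.commute[of f g])
  qed
qed

end

section \<open>Generators and linear functionals\<close>

text \<open>Gaussian elimination. An equation \<open>s\<close> with a nonzero coefficient at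
  \<open>k\<close> is solved for \<open>c k\<close>; the remaining equations then involve the
  unknowns in \<open>J - {k}\<close> and are still fewer than these.\<close>

lemma homogeneous_system_nontrivial:
  fixes A :: "'s \<Rightarrow> 'j \<Rightarrow> 'k::field"
  assumes "finite S" "finite J" "card S < card J"
  shows "\<exists>c. (\<exists>j \<in> J. c j \<noteq> 0) \<and> (\<forall>s \<in> S. (\<Sum>j \<in> J. c j * A s j) = 0)"
  using assms
proof (induction S arbitrary: J A rule: finite_induct)
  case empty
  then have "J \<noteq> {}" by auto
  then show ?case by (intro exI[of _ "\<lambda>_. 1"]) auto
next
  case (insert s S)
  show ?case
  proof (cases "\<forall>j \<in> J. A s j = 0")
    case True
    have "card S < card J" using insert by simp
    from insert.IH[OF insert.prems(1) this, of A] show ?thesis using True by auto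
  next
    case False
    then obtain k where k: "k \<in> J" "A s k \<noteq> 0" by blast
    let ?J = "J - {k}"
    have "finite ?J" "card S < card ?J" using insert k by simp_all
    from insert.IH[OF this, of "\<lambda>t j. A t j - A t k * A s j / A s k"]
    obtain c where c: "\<exists>j \<in> ?J. c j \<noteq> 0"
      "\<forall>t \<in> S. (\<Sum>j \<in> ?J. c j * (A t j - A t k * A s j / A s k)) = 0"
      by (elim exE conjE)
    \<comment> \<open>Back substitution: the value of the unknown \<open>k\<close> forced by
      equation \<open>s\<close>.\<close>
    define c' where "c' = c (k := - (\<Sum>j \<in> ?J. c j * A s j) / A s k)"
    have sum: "(\<Sum>j \<in> J. c' j * A t j) =
        (\<Sum>j \<in> ?J. c j * A t j) - (\<Sum>j \<in> ?J. c j * A s j) / A s k * A t k" for t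
    proof -
      have "(\<Sum>j \<in> J. c' j * A t j) = c' k * A t k + (\<Sum>j \<in> ?J. c' j * A t j)"
        using k insert.prems by (simp add: sum.remove)
      also have "(\<Sum>j \<in> ?J. c' j * A t j) = (\<Sum>j \<in> ?J. c j * A t j)"
        by (rule sum.cong) (auto simp: c'_def)
      finally show ?thesis by (simp add: c'_def)
    qed
    have "(\<Sum>j \<in> J. c' j * A t j) = 0" if "t \<in> S" for t
    proof -
      have "(\<Sum>j \<in> ?J. c j * (A t j - A t k * A s j / A s k)) =
          (\<Sum>j \<in> ?J. c j * A t j - c j * A s j * (A t k / A s k))"
        by (rule sum.cong) (simp_all add: algebra_simps)
      also have "\<dots> = (\<Sum>j \<in> ?J. c j * A t j) - (\<Sum>j \<in> ?J. c j * A s j) / A s k * A t k"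
        by (simp add: sum_subtractf sum_distrib_right sum_divide_distrib)
      finally show ?thesis using c(2) that by (simp add: sum)
    qed
    moreover have "(\<Sum>j \<in> J. c' j * A s j) = 0" using k by (simp add: sum)
    moreover have "\<exists>j \<in> J. c' j \<noteq> 0" using c(1) by (auto simp: c'_def)
    ultimately show ?thesis by (intro exI[of _ c']) auto
  qed
qed

text \<open>A combination of the functionals that vanishes on the generators vanishes on the whole ideal,
  because its zeros in the ideal form an ideal.\<close>

lemma generators_functionals:
  fixes \<phi> :: "'j \<Rightarrow> 'k::field mpoly \<Rightarrow> 'k"
  assumes I: "ideal I (mpoly_ring n)"
    and S: "finite S" "S \<subseteq> carrier (mpoly_ring n)" "genideal (mpoly_ring n) S = I"
    and J: "finite J" "card S < card J"
    and add: "\<And>j f g. j \<in> J \<Longrightarrow> \<phi> j (f + g) = \<phi> j f + \<phi> j g"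
    and mult: "\<And>j w c f. j \<in> J \<Longrightarrow> f \<in> I \<Longrightarrow> \<phi> j (Poly_Mapping.single w c * f) = \<epsilon> w c * \<phi> j f"
  shows "\<exists>c. (\<exists>j \<in> J. c j \<noteq> 0) \<and> (\<forall>f \<in> I. (\<Sum>j \<in> J. c j * \<phi> j f) = 0)"
proof -
  interpret R: cring "mpoly_ring n" by (rule mpoly_ring_cring)
  obtain c where c: "\<exists>j \<in> J. c j \<noteq> 0" "\<forall>s \<in> S. (\<Sum>j \<in> J. c j * \<phi> j s) = 0"
    using homogeneous_system_nontrivial[OF S(1) J, of "\<lambda>s j. \<phi> j s"] by blast
  let ?K = "{f \<in> I. (\<Sum>j \<in> J. c j * \<phi> j f) = 0}"
  have "ideal ?K (mpoly_ring n)"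
  proof (rule ideal_of_functional[OF I])
    show "(\<Sum>j \<in> J. c j * \<phi> j (f + g)) = (\<Sum>j \<in> J. c j * \<phi> j f) + (\<Sum>j \<in> J. c j * \<phi> j g)" for f g
      unfolding sum.distrib[symmetric] by (intro sum.cong) (simp_all add: add distrib_left)
    show "(\<Sum>j \<in> J. c j * \<phi> j (Poly_Mapping.single w a * f)) = 0"
      if f: "f \<in> I" "(\<Sum>j \<in> J. c j * \<phi> j f) = 0" for w a f
    proof -
      have "(\<Sum>j \<in> J. c j * \<phi> j (Poly_Mapping.single w a * f)) = \<epsilon> w a * (\<Sum>j \<in> J. c j * \<phi> j f)"
        unfolding sum_distrib_left using f by (intro sum.cong) (simp_all add: mult mult.left_commute)
      then show ?thesis using f(2) by (simp only: mult_zero_right)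
    qed
  qed
  moreover have "S \<subseteq> ?K" using c(2) R.genideal_self[OF S(2)] S(3) by auto
  ultimately have "genideal (mpoly_ring n) S \<subseteq> ?K" by (rule R.genideal_minimal)
  then have "I \<subseteq> ?K" unfolding S(3) .
  then show ?thesis using c(1) by blast
qed

lemma min_num_generators_ge:
  assumes "\<And>S. finite S \<Longrightarrow> S \<subseteq> carrier R \<Longrightarrow> genideal R S = I \<Longrightarrow> r \<le> card S"
  shows "enat r \<le> min_num_generators R I"
  unfolding min_num_generators_def using assms by (intro INF_greatest) auto

lemma min_num_generators_le:
  assumes "finite S" "S \<subseteq> carrier R" "genideal R S = I"
  shows "min_num_generators R I \<le> enat (card S)"
  unfolding min_num_generators_def using assms by (intro INF_lower) auto

subsection \<open>Toric ideals\<close>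

lemma mem_toric_ideal:
  "f \<in> toric_ideal n d \<longleftrightarrow> f \<in> carrier (mpoly_ring n) \<and> toric_hom d f = 0"
  by (simp add: toric_ideal_def a_kernel_def' upoly_ring_def)

lemma toric_hom_eq_wdeg:
  "toric_hom d f = (\<Sum>m \<in> Poly_Mapping.keys f. Polynomial.monom (Poly_Mapping.lookup f m) (wdeg d m))"
  by (simp add: toric_hom_alt wdeg_def)

lemma coeff_toric_hom:
  "Polynomial.coeff (toric_hom d f) b =
    (\<Sum>m \<in> {m \<in> Poly_Mapping.keys f. wdeg d m = b}. Poly_Mapping.lookup f m)"
  by (simp add: toric_hom_eq_wdeg coeff_sum sum.inter_filter)

lemma binomial_mem_toric_ideal:
  assumes "Poly_Mapping.keys u \<subseteq> {1..n}" "Poly_Mapping.keys v \<subseteq> {1..n}" "wdeg d u = wdeg d v"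
  shows "xpow u - xpow v \<in> (toric_ideal n d :: 'k::field mpoly set)"
proof -
  have "toric_hom d (xpow u - xpow v :: 'k mpoly) + toric_hom d (xpow v) = toric_hom d (xpow u)"
    by (simp only: toric_hom_add[symmetric] diff_add_cancel)
  moreover have "toric_hom d (xpow u :: 'k mpoly) = toric_hom d (xpow v)"
    using assms(3) by (simp add: toric_hom_single wdeg_def)
  moreover have "xpow u - xpow v \<in> carrier (mpoly_ring n :: 'k mpoly ring)"
    unfolding mem_carrier_mpoly_ring
  proof
    fix m assume "m \<in> Poly_Mapping.keys (xpow u - xpow v :: 'k mpoly)"
    then have "m = u \<or> m = v"
      by (auto simp: in_keys_iff lookup_minus lookup_single when_def split: if_splits)
    then show "Poly_Mapping.keys m \<subseteq> {1..n}" using assms by blast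
  qed
  ultimately show ?thesis by (simp only: mem_toric_ideal add_cancel_left_left simp_thms)
qed

text \<open>The toric ideal is generated by its binomials. Replacing each monomial of
  \<open>f\<close> by a fixed representative \<open>r b\<close> of its degree \<open>b\<close>
  changes \<open>f\<close> by a combination of binomials, and the result is 0 because the
  coefficients of \<open>f\<close> in each degree add up to 0.\<close>

lemma toric_ideal_subset:
  fixes J :: "'k::field mpoly set"
  assumes J: "ideal J (mpoly_ring n)"
    and binom: "\<And>u v. Poly_Mapping.keys u \<subseteq> {1..n} \<Longrightarrow> Poly_Mapping.keys v \<subseteq> {1..n} \<Longrightarrow>
      wdeg d u = wdeg d v \<Longrightarrow> xpow u - xpow v \<in> J"
  shows "toric_ideal n d \<subseteq> J"
proof
  fix f :: "'k mpoly"
  assume "f \<in> toric_ideal n d"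
  then have f: "f \<in> carrier (mpoly_ring n)" "toric_hom d f = 0" by (simp_all add: mem_toric_ideal)
  define r where "r b = (SOME u. Poly_Mapping.keys u \<subseteq> {1..n} \<and> wdeg d u = b)" for b
  have r: "Poly_Mapping.keys (r (wdeg d u)) \<subseteq> {1..n} \<and> wdeg d (r (wdeg d u)) = wdeg d u"
    if "Poly_Mapping.keys u \<subseteq> {1..n}" for u
    unfolding r_def by (rule someI[of _ u]) (use that in simp)
  let ?c = "Poly_Mapping.lookup f" and ?K = "Poly_Mapping.keys f"
  have "(\<Sum>m \<in> ?K. Poly_Mapping.single (r (wdeg d m)) (?c m)) =
      (\<Sum>b \<in> wdeg d ` ?K. \<Sum>m \<in> {m \<in> ?K. wdeg d m = b}. Poly_Mapping.single (r (wdeg d m)) (?c m))"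
    by (rule sum.image_gen) simp
  also have "\<dots> = (\<Sum>b \<in> wdeg d ` ?K. Poly_Mapping.single (r b) (\<Sum>m \<in> {m \<in> ?K. wdeg d m = b}. ?c m))"
    by (rule sum.cong) (simp_all add: additive_sum[of "Poly_Mapping.single _", OF single_add])
  also have "\<dots> = 0" using f(2) by (simp add: coeff_toric_hom[symmetric])
  finally have "f = (\<Sum>m \<in> ?K. Poly_Mapping.single m (?c m)) -
      (\<Sum>m \<in> ?K. Poly_Mapping.single (r (wdeg d m)) (?c m))"
    by (simp add: poly_mapping_expand)
  also have "\<dots> = (\<Sum>m \<in> ?K. Poly_Mapping.single 0 (?c m) * (xpow m - xpow (r (wdeg d m))))"
    by (simp add: sum_subtractf right_diff_distrib mult_single)
  also have "\<dots> \<in> J"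
  proof (intro ideal_sum[OF J] ideal_mult[OF J] binom)
    show "Poly_Mapping.keys m \<subseteq> {1..n}" if "m \<in> ?K" for m
      using f(1) that by (auto simp: mem_carrier_mpoly_ring)
    then show "Poly_Mapping.keys (r (wdeg d m)) \<subseteq> {1..n}" "wdeg d m = wdeg d (r (wdeg d m))"
      if "m \<in> ?K" for m
      using r that by auto
  qed (simp add: single_mem_carrier)
  finally show "f \<in> J" .
qed

subsection \<open>Lower bounds for the number of generators\<close>

text \<open>Evaluation of \<open>toric_hom d f = 0\<close> at \<open>t = 1\<close>; the sum is the
  value of \<open>f\<close> at \<open>(1, ..., 1)\<close>.\<close>

lemma toric_ideal_sum_lookup:
  fixes f :: "'k::field mpoly"
  assumes "f \<in> toric_ideal n d"
  shows "(\<Sum>m \<in> Poly_Mapping.keys f. Poly_Mapping.lookup f m) = 0"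
proof -
  have "poly (toric_hom d f) 1 = 0" using assms by (simp add: mem_toric_ideal)
  then show ?thesis by (simp add: toric_hom_eq_wdeg poly_sum poly_monom)
qed

text \<open>The functionals are the partial derivatives at \<open>(1, \<dots>, 1)\<close>, a zero of the ideal.\<close>

lemma toric_min_num_generators_ge:
  assumes pos: "\<And>i. i \<in> {1..n} \<Longrightarrow> 0 < d i"
  shows "enat (n - 1) \<le> min_num_generators (mpoly_ring n) (toric_ideal n d :: 'k::field mpoly set)"
proof (rule min_num_generators_ge, rule ccontr)
  fix S :: "'k mpoly set"
  assume S: "finite S" "S \<subseteq> carrier (mpoly_ring n)" "genideal (mpoly_ring n) S = toric_ideal n d"
    and "\<not> n - 1 \<le> card S"
  then have card: "card S < n - 1" by simp
  define G where "G = Gcd (d ` {1..n})"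
  have "n > 0" using card by simp
  have G: "G dvd d i" if "i \<in> {1..n}" for i
    unfolding G_def using that by (intro Gcd_dvd) simp
  have "G \<noteq> 0" using G[of 1] pos[of 1] \<open>n > 0\<close> by auto
  \<comment> \<open>If every \<open>d i div G\<close> vanished in the field, the characteristic
    would divide them all, although \<open>G\<close> is the gcd of the \<open>d i\<close>. The
    functional with index \<open>k\<close> is dropped, which leaves \<open>n - 1\<close> of
    them.\<close>
  obtain k where k: "k \<in> {1..n}" "of_nat (d k div G) \<noteq> (0 :: 'k)"
  proof (rule ccontr, goal_cases)
    case 1
    then have "CHAR('k) dvd d i div G" if "i \<in> {1..n}" for i
      using that by (auto simp: of_nat_eq_0_iff_char_dvd)
    then have "CHAR('k) * G dvd d i" if "i \<in> {1..n}" for i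
      using that G[OF that] \<open>G \<noteq> 0\<close> by (metis dvd_div_iff_mult mult.commute)
    then have "CHAR('k) * G dvd G" unfolding G_def by (intro Gcd_greatest) auto
    then have "CHAR('k) = 1" using \<open>G \<noteq> 0\<close> by simp
    then show False by simp
  qed
  define \<phi> where "\<phi> j f = (\<Sum>m \<in> Poly_Mapping.keys f. Poly_Mapping.lookup f m * of_nat (Poly_Mapping.lookup m j))"
    for j and f :: "'k mpoly"
  have add: "\<phi> j (f + g) = \<phi> j f + \<phi> j g" for j f g
    unfolding \<phi>_def by (rule setsum_keys_plus_distrib) (simp_all add: algebra_simps)
  have single: "\<phi> j (Poly_Mapping.single m c) = c * of_nat (Poly_Mapping.lookup m j)" for j m c
    by (simp add: \<phi>_def)
  \<comment> \<open>Product rule: the derivative of the multiplier comes with the value of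
    \<open>f\<close> at \<open>(1, ..., 1)\<close>, which is 0.\<close>
  have mult: "\<phi> j (Poly_Mapping.single w c * f) = c * \<phi> j f" if "f \<in> toric_ideal n d" for j w c f
  proof -
    have "\<phi> j (Poly_Mapping.single w c * f) =
        (\<Sum>m \<in> Poly_Mapping.keys f. c * Poly_Mapping.lookup f m * of_nat (Poly_Mapping.lookup (w + m) j))"
      by (simp add: single_mult_eq_sum additive_sum[of "\<phi> j", OF add] single)
    also have "\<dots> = c * of_nat (Poly_Mapping.lookup w j) * (\<Sum>m \<in> Poly_Mapping.keys f. Poly_Mapping.lookup f m) +
        c * \<phi> j f"
      by (simp add: \<phi>_def lookup_add algebra_simps sum.distrib sum_distrib_left)
    finally show ?thesis using toric_ideal_sum_lookup[OF that] by simp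
  qed
  have "\<exists>c. (\<exists>j \<in> {1..n} - {k}. c j \<noteq> 0) \<and>
      (\<forall>f \<in> toric_ideal n d. (\<Sum>j \<in> {1..n} - {k}. c j * \<phi> j f) = 0)"
    by (rule generators_functionals[OF toric_ideal_ideal S, where \<epsilon> = "\<lambda>w c. c"])
      (use card k add mult in auto)
  then obtain c i where c: "i \<in> {1..n} - {k}" "c i \<noteq> 0"
    "\<And>f. f \<in> toric_ideal n d \<Longrightarrow> (\<Sum>j \<in> {1..n} - {k}. c j * \<phi> j f) = 0"
    by blast
  \<comment> \<open>Apart from \<open>x_k\<close>, this binomial involves only \<open>x_i\<close>,
    so it isolates the coefficient \<open>c i\<close>.\<close>
  let ?u = "Poly_Mapping.single i (d k div G)" and ?v = "Poly_Mapping.single k (d i div G)"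
  have "xpow ?u - xpow ?v \<in> (toric_ideal n d :: 'k mpoly set)"
    using c(1) k G[of i] G[of k] by (intro binomial_mem_toric_ideal) (auto simp: div_mult_swap mult.commute)
  then have "0 = (\<Sum>j \<in> {1..n} - {k}. c j * \<phi> j (xpow ?u - xpow ?v))" using c(3) by simp
  also have "\<dots> = (\<Sum>j \<in> {1..n} - {k}. if j = i then c i * of_nat (d k div G) else 0)"
  proof (rule sum.cong)
    fix j assume j: "j \<in> {1..n} - {k}"
    have "\<phi> j (xpow ?u - xpow ?v) + \<phi> j (xpow ?v) = \<phi> j (xpow ?u)"
      by (simp only: add[symmetric] diff_add_cancel)
    then show "c j * \<phi> j (xpow ?u - xpow ?v) = (if j = i then c i * of_nat (d k div G) else 0)"
      using j by (auto simp: single lookup_single when_def)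
  qed simp
  also have "\<dots> = c i * of_nat (d k div G)" using c(1) by simp
  finally show False using c(2) k(2) by simp
qed

text \<open>The functionals are the coefficients of the pure powers \<open>x\<^sub>i ^ m i\<close>; by minimality of
  \<open>m i\<close> they vanish on the product of the ideal with the maximal ideal at the origin.\<close>

lemma toric_min_num_generators_ge_powers:
  assumes pos: "\<And>i. i \<in> {1..n} \<Longrightarrow> 0 < d i"
    and w: "\<And>i. i \<in> {1..n} \<Longrightarrow> Poly_Mapping.keys (w i) \<subseteq> {1..n} - {i}"
      "\<And>i. i \<in> {1..n} \<Longrightarrow> wdeg d (w i) = m i * d i"
    and minimal: "\<And>i k u. i \<in> {1..n} \<Longrightarrow> 0 < k \<Longrightarrow> k < m i \<Longrightarrow>
      Poly_Mapping.keys u \<subseteq> {1..n} - {i} \<Longrightarrow> wdeg d u \<noteq> k * d i"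
    and m: "\<And>i. i \<in> {1..n} \<Longrightarrow> 0 < m i"
    and inj: "inj_on (\<lambda>i. m i * d i) {1..n}"
  shows "enat n \<le> min_num_generators (mpoly_ring n) (toric_ideal n d :: 'k::field mpoly set)"
proof (rule min_num_generators_ge, rule ccontr)
  fix S :: "'k mpoly set"
  assume S: "finite S" "S \<subseteq> carrier (mpoly_ring n)" "genideal (mpoly_ring n) S = toric_ideal n d"
    and card: "\<not> n \<le> card S"
  define \<phi> where "\<phi> i f = Poly_Mapping.lookup f (Poly_Mapping.single i (m i))" for i and f :: "'k mpoly"
  \<comment> \<open>Splitting off the power of \<open>x_i\<close> from \<open>u\<close> leaves a
    monomial \<open>v\<close> in the other variables of degree \<open>(k - t) * d i\<close>.
    Minimality of \<open>m i\<close> forces \<open>t = k\<close>, and then \<open>v\<close> has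
    degree 0.\<close>
  have only: "u = Poly_Mapping.single i k"
    if "i \<in> {1..n}" "k < m i" "Poly_Mapping.keys u \<subseteq> {1..n}" "wdeg d u = k * d i" for i k u
  proof -
    define t where "t = Poly_Mapping.lookup u i"
    define v where "v = u - Poly_Mapping.single i t"
    have uv: "u = v + Poly_Mapping.single i t"
      by (rule poly_mapping_eqI) (simp add: v_def t_def lookup_add lookup_minus lookup_single when_def)
    have keys: "Poly_Mapping.keys v \<subseteq> {1..n} - {i}"
      using that(3) by (auto simp: v_def t_def in_keys_iff lookup_minus lookup_single when_def split: if_splits)
    have deg: "wdeg d v + t * d i = k * d i" using that(4) unfolding uv by (simp add: wdeg_add)
    then have "t * d i \<le> k * d i" by linarith
    then have "t \<le> k" using pos[OF that(1)] by simp
    have vdeg: "wdeg d v = (k - t) * d i" using deg by (simp add: diff_mult_distrib)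
    have "t = k"
    proof (rule ccontr)
      assume "t \<noteq> k"
      then have "0 < k - t" "k - t < m i" using that(2) \<open>t \<le> k\<close> by linarith+
      from minimal[OF that(1) this keys] show False using vdeg by contradiction
    qed
    then have "wdeg d v = 0" using deg by simp
    then have zero: "Poly_Mapping.lookup v j * d j = 0" if "j \<in> Poly_Mapping.keys v" for j
      using that by (simp add: wdeg_def)
    have "Poly_Mapping.keys v = {}"
    proof (rule equals0I)
      fix j assume j: "j \<in> Poly_Mapping.keys v"
      then have "0 < d j" using keys pos by blast
      then show False using zero[OF j] j by (simp add: in_keys_iff)
    qed
    then have "v = 0" using poly_mapping_expand[of v] by simp
    then show ?thesis using uv \<open>t = k\<close> by simp
  qed
  \<comment> \<open>The coefficient of \<open>x_i^k\<close> in \<open>f\<close> is thus the whole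
    coefficient of \<open>t^(k * d i)\<close> in its image.\<close>
  have vanish: "Poly_Mapping.lookup f (Poly_Mapping.single i k) = 0"
    if "i \<in> {1..n}" "k < m i" "f \<in> toric_ideal n d" for i k and f :: "'k mpoly"
  proof (rule ccontr)
    assume nz: "Poly_Mapping.lookup f (Poly_Mapping.single i k) \<noteq> 0"
    have "{u \<in> Poly_Mapping.keys f. wdeg d u = k * d i} = {Poly_Mapping.single i k}"
      using only[OF that(1,2)] that(3) nz by (auto simp: mem_toric_ideal mem_carrier_mpoly_ring in_keys_iff)
    then have "Polynomial.coeff (toric_hom d f) (k * d i) = Poly_Mapping.lookup f (Poly_Mapping.single i k)"
      by (simp add: coeff_toric_hom)
    then show False using nz that(3) by (simp add: mem_toric_ideal)
  qed
  \<comment> \<open>If \<open>v\<close> is not 0, a monomial \<open>u\<close> with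
    \<open>v + u = Poly_Mapping.single i (m i)\<close> is a lower power of \<open>x_i\<close>, and
    its coefficient in \<open>f\<close> vanishes. The factor \<open>c when v = 0\<close> is the
    value of the multiplier at the origin.\<close>
  have mult: "\<phi> i (Poly_Mapping.single v c * f) = (c when v = 0) * \<phi> i f"
    if "i \<in> {1..n}" "f \<in> toric_ideal n d" for i v c f
  proof -
    have *: "\<phi> i (Poly_Mapping.single v c * f) =
        (\<Sum>u \<in> Poly_Mapping.keys f. (c * Poly_Mapping.lookup f u when v + u = Poly_Mapping.single i (m i)))"
      by (simp add: \<phi>_def single_mult_eq_sum lookup_sum lookup_single)
    show ?thesis
    proof (cases "v = 0")
      case True
      then show ?thesis unfolding * by (simp add: \<phi>_def when_def in_keys_iff)
    next
      case False
      have "Poly_Mapping.lookup f u = 0" if u: "v + u = Poly_Mapping.single i (m i)" for u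
      proof -
        have lookup: "Poly_Mapping.lookup v j + Poly_Mapping.lookup u j = (m i when i = j)" for j
          unfolding lookup_add[symmetric] u by (rule lookup_single)
        have sum: "Poly_Mapping.lookup v i + Poly_Mapping.lookup u i = m i"
          using lookup[of i] by simp
        have z: "Poly_Mapping.lookup v j = 0 \<and> Poly_Mapping.lookup u j = 0" if "j \<noteq> i" for j
          using lookup[of j] that by simp
        have "u = Poly_Mapping.single i (Poly_Mapping.lookup u i)"
          "v = Poly_Mapping.single i (Poly_Mapping.lookup v i)"
          by (rule poly_mapping_eqI, use z in \<open>auto simp: lookup_single when_def\<close>)+
        moreover have "Poly_Mapping.lookup v i \<noteq> 0" using calculation(2) False by (metis single_zero)
        ultimately show ?thesis
          using vanish[OF \<open>i \<in> {1..n}\<close> _ \<open>f \<in> toric_ideal n d\<close>, of "Poly_Mapping.lookup u i"] sum by simp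
      qed
      then show ?thesis unfolding * using False by (intro trans[OF sum.neutral]) (auto simp: when_def)
    qed
  qed
  have "\<exists>c. (\<exists>j \<in> {1..n}. c j \<noteq> 0) \<and> (\<forall>f \<in> toric_ideal n d. (\<Sum>j \<in> {1..n}. c j * \<phi> j f) = 0)"
    by (rule generators_functionals[OF toric_ideal_ideal S, where \<epsilon> = "\<lambda>v c. (c when v = 0)"])
      (use card mult in \<open>auto simp: \<phi>_def lookup_add\<close>)
  then obtain c i where c: "i \<in> {1..n}" "c i \<noteq> 0"
    "\<And>f. f \<in> toric_ideal n d \<Longrightarrow> (\<Sum>j \<in> {1..n}. c j * \<phi> j f) = 0"
    by blast
  let ?f = "xpow (Poly_Mapping.single i (m i)) - xpow (w i) :: 'k mpoly"
  have "?f \<in> toric_ideal n d"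
    using w[OF c(1)] c(1) by (intro binomial_mem_toric_ideal) auto
  then have "0 = (\<Sum>j \<in> {1..n}. c j * \<phi> j ?f)" using c(3) by simp
  also have "\<dots> = (\<Sum>j \<in> {1..n}. if j = i then c i else 0)"
  proof (rule sum.cong)
    fix j assume j: "j \<in> {1..n}"
    \<comment> \<open>Equality would make the degrees for \<open>i\<close> and \<open>j\<close>
      agree, hence \<open>j = i\<close> by injectivity, but \<open>w i\<close> does not involve
      \<open>x_i\<close>.\<close>
    have "w i \<noteq> Poly_Mapping.single j (m j)"
    proof
      assume wi: "w i = Poly_Mapping.single j (m j)"
      then have "m j * d j = m i * d i" using w(2)[OF c(1)] by simp
      then have "j = i" using inj j c(1) by (auto dest: inj_onD)
      then show False using w(1)[OF c(1)] wi m[OF c(1)] by auto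
    qed
    moreover have "Poly_Mapping.single i (m i) = Poly_Mapping.single j (m j) \<longleftrightarrow> j = i"
    proof
      assume eq: "Poly_Mapping.single i (m i) = Poly_Mapping.single j (m j)"
      have "Poly_Mapping.keys (Poly_Mapping.single i (m i)) = {i}" using m[OF c(1)] by simp
      moreover have "Poly_Mapping.keys (Poly_Mapping.single j (m j)) = {j}" using m[OF j] by simp
      ultimately show "j = i" unfolding eq by simp
    qed simp
    ultimately show "c j * \<phi> j ?f = (if j = i then c i else 0)"
      by (auto simp: \<phi>_def lookup_minus lookup_single when_def)
  qed simp
  also have "\<dots> = c i" using c(1) by simp
  finally show False using c(2) by simp
qed

section \<open>Congruence of monomials modulo an ideal, and upper bounds for the number of
  generators\<close>

definition mono_cong :: "'k::field mpoly set \<Rightarrow> (nat \<Rightarrow>\<^sub>0 nat) \<Rightarrow> (nat \<Rightarrow>\<^sub>0 nat) \<Rightarrow> bool" where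
  "mono_cong J u v \<longleftrightarrow> xpow u - xpow v \<in> J"

lemma keys_add_subset:
  fixes u v :: "nat \<Rightarrow>\<^sub>0 nat"
  shows "Poly_Mapping.keys u \<subseteq> A \<Longrightarrow> Poly_Mapping.keys v \<subseteq> A \<Longrightarrow> Poly_Mapping.keys (u + v) \<subseteq> A"
  using Poly_Mapping.keys_add[of u v] by blast

lemma keys_single_subset: "i \<in> A \<Longrightarrow> Poly_Mapping.keys (Poly_Mapping.single i k) \<subseteq> A"
  by simp

lemma keys_sum_subset:
  fixes f :: "'i \<Rightarrow> nat \<Rightarrow>\<^sub>0 nat"
  shows "(\<And>i. i \<in> B \<Longrightarrow> Poly_Mapping.keys (f i) \<subseteq> A) \<Longrightarrow> Poly_Mapping.keys (sum f B) \<subseteq> A"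
  by (induction B rule: infinite_finite_induct) (simp_all add: keys_add_subset)

context
  fixes J :: "'k::field mpoly set" and n :: nat
  assumes J: "ideal J (mpoly_ring n)"
begin

lemma mono_cong_refl: "mono_cong J u u"
  by (simp add: mono_cong_def ideal_zero[OF J])

lemma mono_cong_sym: "mono_cong J u v \<Longrightarrow> mono_cong J v u"
  using ideal_uminus[OF J, of "xpow u - xpow v"] by (simp add: mono_cong_def)

lemma mono_cong_trans: "mono_cong J u v \<Longrightarrow> mono_cong J v w \<Longrightarrow> mono_cong J u w"
  using ideal_add[OF J, of "xpow u - xpow v" "xpow v - xpow w"] by (simp add: mono_cong_def)

lemma mono_cong_add_left:
  assumes "mono_cong J u v" "Poly_Mapping.keys w \<subseteq> {1..n}"
  shows "mono_cong J (w + u) (w + v)"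
proof -
  have "xpow w * (xpow u - xpow v) \<in> J"
    using assms by (intro ideal_mult[OF J] single_mem_carrier) (simp_all add: mono_cong_def)
  then show ?thesis by (simp add: mono_cong_def right_diff_distrib mult_single)
qed

text \<open>The path is \<open>u + v\<close>, \<open>u + v'\<close>, \<open>u' + v'\<close>, so the
  two multipliers are \<open>u\<close> and \<open>v'\<close>, the ones required to lie in the
  ring.\<close>

lemma mono_cong_add:
  assumes "mono_cong J u u'" "mono_cong J v v'"
    and "Poly_Mapping.keys u \<subseteq> {1..n}" "Poly_Mapping.keys v' \<subseteq> {1..n}"
  shows "mono_cong J (u + v) (u' + v')"
proof (rule mono_cong_trans)
  show "mono_cong J (u + v) (u + v')" using assms by (intro mono_cong_add_left)
  show "mono_cong J (u + v') (u' + v')"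
    using mono_cong_add_left[OF assms(1,4)] by (simp add: add.commute)
qed

lemma mono_cong_sum:
  assumes "\<And>i. i \<in> A \<Longrightarrow> mono_cong J (f i) (g i)"
    and "\<And>i. i \<in> A \<Longrightarrow> Poly_Mapping.keys (f i) \<subseteq> {1..n}"
    and "\<And>i. i \<in> A \<Longrightarrow> Poly_Mapping.keys (g i) \<subseteq> {1..n}"
  shows "mono_cong J (sum f A) (sum g A)"
  using assms
  by (induction A rule: infinite_finite_induct)
    (simp_all add: mono_cong_refl mono_cong_add keys_sum_subset)

text \<open>The \<open>k\<close>-th power of a rewriting rule for a power of \<open>x_i\<close>. A
  right-hand side in a single variable is covered by \<open>j = l\<close> and exponent 0.\<close>

lemma mono_cong_mult:
  assumes "mono_cong J (Poly_Mapping.single i s) (Poly_Mapping.single j u + Poly_Mapping.single l v)"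
    and "i \<in> {1..n}" "j \<in> {1..n}" "l \<in> {1..n}"
  shows "mono_cong J (Poly_Mapping.single i (k * s))
    (Poly_Mapping.single j (k * u) + Poly_Mapping.single l (k * v))"
proof (induction k)
  case (Suc k)
  have "mono_cong J (Poly_Mapping.single i s + Poly_Mapping.single i (k * s))
      ((Poly_Mapping.single j u + Poly_Mapping.single l v) +
       (Poly_Mapping.single j (k * u) + Poly_Mapping.single l (k * v)))"
    using assms by (intro mono_cong_add[OF _ Suc.IH] keys_add_subset keys_single_subset)
  then show ?case by (simp add: single_add ac_simps)
qed (simp add: mono_cong_refl)

text \<open>The toric ideal of two integers is principal. With \<open>x = d i div g\<close>,
  \<open>y = d j div g\<close> coprime, cancelling common factors leaves
  \<open>e * x = f * y\<close>, so \<open>e = t * y\<close> and \<open>f = t * x\<close>: the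
  \<open>t\<close>-th power of the given relation.\<close>

lemma mono_cong_two_variables:
  assumes ij: "i \<in> {1..n}" "j \<in> {1..n}" and pos: "0 < d i" "0 < d j"
    and cong: "mono_cong J (Poly_Mapping.single i (d j div gcd (d i) (d j)))
      (Poly_Mapping.single j (d i div gcd (d i) (d j)))"
    and eq: "\<alpha> * d i + \<beta> * d j = \<gamma> * d i + \<delta> * d j"
  shows "mono_cong J (Poly_Mapping.single i \<alpha> + Poly_Mapping.single j \<beta>)
    (Poly_Mapping.single i \<gamma> + Poly_Mapping.single j \<delta>)"
proof -
  have le: "mono_cong J (Poly_Mapping.single i \<alpha> + Poly_Mapping.single j \<beta>)
      (Poly_Mapping.single i \<gamma> + Poly_Mapping.single j \<delta>)"
    if eq: "\<alpha> * d i + \<beta> * d j = \<gamma> * d i + \<delta> * d j" and "\<gamma> \<le> \<alpha>" for \<alpha> \<beta> \<gamma> \<delta>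
  proof -
    define g x y where "g = gcd (d i) (d j)" and "x = d i div g" and "y = d j div g"
    have xy: "d i = g * x" "d j = g * y" by (simp_all add: g_def x_def y_def)
    have "g > 0" using pos by (simp add: g_def)
    have "coprime x y" unfolding x_def y_def g_def using pos by (intro div_gcd_coprime) auto
    obtain e where e: "\<alpha> = \<gamma> + e" using \<open>\<gamma> \<le> \<alpha>\<close> le_Suc_ex by blast
    have "e * d i + \<beta> * d j = \<delta> * d j" using eq e by (simp add: algebra_simps)
    then have "g * (e * x + \<beta> * y) = g * (\<delta> * y)" unfolding xy by (simp add: algebra_simps)
    then have eq': "e * x + \<beta> * y = \<delta> * y" using \<open>g > 0\<close> by simp
    have "y > 0" using xy pos by (cases y) auto
    have "\<beta> * y \<le> \<delta> * y" using eq' by linarith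
    then have "\<beta> \<le> \<delta>" using \<open>y > 0\<close> by simp
    then obtain f where f: "\<delta> = \<beta> + f" using le_Suc_ex by blast
    have ef: "e * x = f * y" using eq' f by (simp add: algebra_simps)
    then have "y dvd e * x" by simp
    then have "y dvd e" using \<open>coprime x y\<close> by (simp add: coprime_dvd_mult_left_iff coprime_commute)
    then obtain t where t: "e = t * y" by (metis dvd_def mult.commute)
    then have ft: "f = t * x" using ef \<open>y > 0\<close> by (simp add: ac_simps)
    have "mono_cong J (Poly_Mapping.single i (t * y)) (Poly_Mapping.single j (t * x) + Poly_Mapping.single j (t * 0))"
      using cong ij by (intro mono_cong_mult) (simp_all add: g_def x_def y_def)
    then have "mono_cong J (Poly_Mapping.single i e) (Poly_Mapping.single j f)"
      by (simp add: t ft)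
    then have "mono_cong J ((Poly_Mapping.single i \<gamma> + Poly_Mapping.single j \<beta>) + Poly_Mapping.single i e)
      ((Poly_Mapping.single i \<gamma> + Poly_Mapping.single j \<beta>) + Poly_Mapping.single j f)"
      using ij by (intro mono_cong_add_left keys_add_subset keys_single_subset)
    then show ?thesis by (simp add: e f single_add ac_simps)
  qed
  show ?thesis
  proof (cases "\<gamma> \<le> \<alpha>")
    case True
    show ?thesis by (rule le[OF eq True])
  next
    case False
    then show ?thesis using le[OF eq[symmetric]] mono_cong_sym by simp
  qed
qed

end

text \<open>Since the lower bound \<open>n - 1\<close> always holds and binomials generate the toric
  ideal, it is enough that the few relations in \<open>S\<close> already identify all monomials of
  equal degree. The assumption is applied to the ideal generated by \<open>S\<close>.\<close>

lemma min_num_generators_toric_eqI: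
  fixes S :: "'k::field mpoly set"
  assumes pos: "\<And>i. i \<in> {1..n} \<Longrightarrow> 0 < d i"
    and S: "finite S" "card S \<le> n - 1" "S \<subseteq> toric_ideal n d"
    and cong: "\<And>J u v. ideal J (mpoly_ring n) \<Longrightarrow> S \<subseteq> J \<Longrightarrow> Poly_Mapping.keys u \<subseteq> {1..n} \<Longrightarrow>
      Poly_Mapping.keys v \<subseteq> {1..n} \<Longrightarrow> wdeg d u = wdeg d v \<Longrightarrow> mono_cong J u v"
  shows "min_num_generators (mpoly_ring n) (toric_ideal n d :: 'k mpoly set) = enat (n - 1)"
proof (rule antisym)
  interpret R: cring "mpoly_ring n :: 'k mpoly ring" by (rule mpoly_ring_cring)
  let ?J = "genideal (mpoly_ring n) S"
  have carrier: "S \<subseteq> carrier (mpoly_ring n)" using S(3) by (auto simp: mem_toric_ideal)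
  have J: "ideal ?J (mpoly_ring n)" by (rule R.genideal_ideal[OF carrier])
  have "toric_ideal n d \<subseteq> ?J"
    using cong[OF J R.genideal_self[OF carrier]] unfolding mono_cong_def
    by (intro toric_ideal_subset[OF J])
  moreover have "?J \<subseteq> toric_ideal n d"
    by (rule R.genideal_minimal[OF toric_ideal_ideal S(3)])
  ultimately have "?J = toric_ideal n d" by blast
  then have "min_num_generators (mpoly_ring n) (toric_ideal n d :: 'k mpoly set) \<le> enat (card S)"
    by (rule min_num_generators_le[OF S(1) carrier])
  also have "\<dots> \<le> enat (n - 1)" using S(2) by simp
  finally show "min_num_generators (mpoly_ring n) (toric_ideal n d :: 'k mpoly set) \<le> enat (n - 1)" .
qed (rule toric_min_num_generators_ge[OF pos])

text \<open>Modulo \<open>x_i - x_1^(U i) x_2^(V i)\<close> for \<open>i \<ge> 3\<close>, every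
  monomial becomes one in \<open>x_1\<close> and \<open>x_2\<close> of the same degree, and a single
  binomial relates these. That makes \<open>(n - 2) + 1\<close> generators.\<close>

lemma toric_complete_intersection_if_in_semigroup:
  assumes "2 \<le> n" and pos: "\<And>i. i \<in> {1..n} \<Longrightarrow> 0 < d i"
    and semigroup: "\<And>i. i \<in> {3..n} \<Longrightarrow> \<exists>u v. d i = u * d 1 + v * d 2"
  shows "toric_complete_intersection n (toric_ideal n d :: 'k::field mpoly set)"
  unfolding toric_complete_intersection_def
proof -
  have "\<exists>w. i \<in> {3..n} \<longrightarrow> d i = fst w * d 1 + snd w * d 2" for i
    using semigroup[of i] by (cases "i \<in> {3..n}") force+
  then have "\<exists>W. \<forall>i. i \<in> {3..n} \<longrightarrow> d i = fst (W i) * d 1 + snd (W i) * d 2"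
    by (intro choice allI)
  then obtain W where W: "d i = fst (W i) * d 1 + snd (W i) * d 2" if "i \<in> {3..n}" for i
    by blast
  \<comment> \<open>Extended to the indices 1 and 2 so that \<open>d_eq\<close> treats all variables
    alike.\<close>
  define U V where "U i = (if i = 1 then 1 else if i = 2 then 0 else fst (W i))"
    and "V i = (if i = 1 then 0 else if i = 2 then 1 else snd (W i))" for i
  have UV: "U 1 = 1" "V 1 = 0" "U 2 = 0" "V 2 = 1" by (simp_all add: U_def V_def)
  have d_eq: "d i = U i * d 1 + V i * d 2" if "i \<in> {1..n}" for i
  proof (cases "i = 1 \<or> i = 2")
    case False
    then have "i \<in> {3..n}" using that unfolding atLeastAtMost_iff by linarith
    then show ?thesis using W[of i] False by (simp add: U_def V_def)
  qed (auto simp: U_def V_def)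
  \<comment> \<open>\<open>x_2\<close> is not eliminated, so index 2 is free to carry the relation
    between \<open>x_1\<close> and \<open>x_2\<close>.\<close>
  define gen :: "nat \<Rightarrow> 'k mpoly" where "gen i = (if i = 2
      then xpow (Poly_Mapping.single 1 (d 2 div gcd (d 1) (d 2))) - xpow (Poly_Mapping.single 2 (d 1 div gcd (d 1) (d 2)))
      else xpow (Poly_Mapping.single i 1) - xpow (Poly_Mapping.single 1 (U i) + Poly_Mapping.single 2 (V i)))" for i
  have n: "1 \<in> {1..n}" "2 \<in> {1..n}" using \<open>2 \<le> n\<close> by auto
  show "min_num_generators (mpoly_ring n) (toric_ideal n d :: 'k mpoly set) = enat (n - 1)"
  proof (rule min_num_generators_toric_eqI[OF pos])
    show "finite (gen ` {2..n})" by simp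
    show "card (gen ` {2..n}) \<le> n - 1" using card_image_le[of "{2..n}" gen] by simp
    show "gen ` {2..n} \<subseteq> toric_ideal n d"
    proof
      fix f assume "f \<in> gen ` {2..n}"
      then obtain i where i: "i \<in> {2..n}" "f = gen i" by blast
      show "f \<in> toric_ideal n d"
      proof (cases "i = 2")
        case True
        have "d 2 div gcd (d 1) (d 2) * d 1 = d 1 div gcd (d 1) (d 2) * d 2"
          by (simp add: div_mult_swap mult.commute)
        moreover have "gen i = xpow (Poly_Mapping.single 1 (d 2 div gcd (d 1) (d 2))) -
            xpow (Poly_Mapping.single 2 (d 1 div gcd (d 1) (d 2)))"
          using True by (simp add: gen_def)
        ultimately show ?thesis unfolding i(2) using n
          by (simp only:) (intro binomial_mem_toric_ideal keys_single_subset; simp)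
      next
        case False
        have "i \<in> {1..n}" using i by auto
        moreover have "gen i = xpow (Poly_Mapping.single i 1) -
            xpow (Poly_Mapping.single 1 (U i) + Poly_Mapping.single 2 (V i))"
          using False by (simp add: gen_def)
        ultimately show ?thesis unfolding i(2) using n d_eq[of i]
          by (simp only:) (intro binomial_mem_toric_ideal keys_single_subset keys_add_subset; simp add: wdeg_add)
      qed
    qed
    fix J :: "'k mpoly set" and u v
    assume J: "ideal J (mpoly_ring n)" and sub: "gen ` {2..n} \<subseteq> J"
      and u: "Poly_Mapping.keys u \<subseteq> {1..n}" and v: "Poly_Mapping.keys v \<subseteq> {1..n}"
      and deg: "wdeg d u = wdeg d v"
    let ?\<alpha> = "\<lambda>u. \<Sum>i \<in> {1..n}. Poly_Mapping.lookup u i * U i"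
    let ?\<beta> = "\<lambda>u. \<Sum>i \<in> {1..n}. Poly_Mapping.lookup u i * V i"
    let ?r = "\<lambda>u. Poly_Mapping.single 1 (?\<alpha> u) + Poly_Mapping.single 2 (?\<beta> u)"
    have reduce: "mono_cong J u (?r u)" if "Poly_Mapping.keys u \<subseteq> {1..n}" for u
    proof -
      have "mono_cong J (Poly_Mapping.single i 1) (Poly_Mapping.single 1 (U i) + Poly_Mapping.single 2 (V i))"
        if i: "i \<in> {1..n}" for i
      proof -
        consider "i = 1" | "i = 2" | "i \<in> {2..n}" "i \<noteq> 2"
          using i unfolding atLeastAtMost_iff by linarith
        then show ?thesis
        proof cases
          case 3
          then have "gen i \<in> J" using sub by blast
          then show ?thesis using 3 by (simp add: gen_def mono_cong_def)
        qed (use UV in \<open>simp_all add: mono_cong_refl[OF J]\<close>)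
      qed
      then have "mono_cong J (Poly_Mapping.single i (Poly_Mapping.lookup u i * 1))
          (Poly_Mapping.single 1 (Poly_Mapping.lookup u i * U i) + Poly_Mapping.single 2 (Poly_Mapping.lookup u i * V i))"
        if "i \<in> {1..n}" for i
        using that n by (intro mono_cong_mult[OF J])
      then have "mono_cong J (\<Sum>i \<in> {1..n}. Poly_Mapping.single i (Poly_Mapping.lookup u i * 1))
          (\<Sum>i \<in> {1..n}. Poly_Mapping.single 1 (Poly_Mapping.lookup u i * U i) +
            Poly_Mapping.single 2 (Poly_Mapping.lookup u i * V i))"
        using n by (intro mono_cong_sum[OF J] keys_add_subset keys_single_subset)
      moreover have "(\<Sum>i \<in> {1..n}. Poly_Mapping.single i (Poly_Mapping.lookup u i * 1)) = u"
        using poly_mapping_expand_superset[of "{1..n}" u] that by simp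
      moreover have "(\<Sum>i \<in> {1..n}. Poly_Mapping.single (1 :: nat) (Poly_Mapping.lookup u i * U i) +
            Poly_Mapping.single 2 (Poly_Mapping.lookup u i * V i)) = ?r u"
        by (rule poly_mapping_eqI)
          (simp add: lookup_add lookup_sum lookup_single when_def sum.distrib)
      ultimately show ?thesis by (simp only:)
    qed
    have r_deg: "?\<alpha> u * d 1 + ?\<beta> u * d 2 = wdeg d u" if "Poly_Mapping.keys u \<subseteq> {1..n}" for u
    proof -
      have "wdeg d u = (\<Sum>i \<in> {1..n}. Poly_Mapping.lookup u i * (U i * d 1 + V i * d 2))"
        unfolding wdeg_eq_sum[OF finite_atLeastAtMost that] by (intro sum.cong refl arg_cong[OF d_eq])
      then show ?thesis by (simp add: distrib_left sum.distrib sum_distrib_right mult.assoc)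
    qed
    have "gen 2 \<in> J" using sub \<open>2 \<le> n\<close> by auto
    then have "mono_cong J (Poly_Mapping.single 1 (d 2 div gcd (d 1) (d 2))) (Poly_Mapping.single 2 (d 1 div gcd (d 1) (d 2)))"
      by (simp add: gen_def mono_cong_def)
    then have "mono_cong J (?r u) (?r v)"
      by (rule mono_cong_two_variables[OF J n pos[OF n(1)] pos[OF n(2)]]) (simp only: r_deg u v deg)
    then show "mono_cong J u v"
      by (intro mono_cong_trans[OF J reduce[OF u] mono_cong_trans[OF J _ mono_cong_sym[OF J reduce[OF v]]]])
  qed
qed

text \<open>The relation \<open>x_2^t = x_1^r x_3^s\<close> reduces the exponent of
  \<open>x_2\<close> below \<open>t\<close>. As \<open>t\<close> divides \<open>d 1\<close> and
  \<open>d 3\<close> and is coprime to \<open>d 2\<close>, the degree determines the reduced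
  exponent; what remains is a relation between \<open>x_1\<close> and \<open>x_3\<close>, where one
  binomial suffices.\<close>

lemma toric_complete_intersection_if_gluing:
  assumes pos: "\<And>i. i \<in> {1..3} \<Longrightarrow> 0 < d i"
    and t: "t dvd d 1" "t dvd d 3" "coprime t (d 2)" "t * d 2 = r * d 1 + s * d 3"
  shows "toric_complete_intersection 3 (toric_ideal 3 d :: 'k::field mpoly set)"
  unfolding toric_complete_intersection_def
proof -
  let ?single = "Poly_Mapping.single :: nat \<Rightarrow> nat \<Rightarrow> nat \<Rightarrow>\<^sub>0 nat"
  define g where "g = gcd (d 1) (d 3)"
  define f h :: "'k mpoly"
    where "f = xpow (?single 2 t) - xpow (?single 1 r + ?single 3 s)"
      and "h = xpow (?single 1 (d 3 div g)) - xpow (?single 3 (d 1 div g))"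
  have in3: "1 \<in> {1..3::nat}" "2 \<in> {1..3::nat}" "3 \<in> {1..3::nat}" by auto
  show "min_num_generators (mpoly_ring 3) (toric_ideal 3 d :: 'k mpoly set) = enat (3 - 1)"
  proof (rule min_num_generators_toric_eqI[OF pos])
    show "finite {f, h}" by simp
    show "card {f, h} \<le> 3 - 1" by (simp add: card_insert_if)
    have "d 3 div g * d 1 = d 1 div g * d 3"
      unfolding g_def by (simp add: div_mult_swap mult.commute)
    then have "h \<in> toric_ideal 3 d"
      unfolding h_def by (intro binomial_mem_toric_ideal keys_single_subset in3) simp
    moreover have "f \<in> toric_ideal 3 d"
      unfolding f_def using t(4)
      by (intro binomial_mem_toric_ideal keys_single_subset keys_add_subset in3) (simp add: wdeg_add)
    ultimately show "{f, h} \<subseteq> toric_ideal 3 d" by simp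
    fix J :: "'k mpoly set" and u v
    assume J: "ideal J (mpoly_ring 3)" and sub: "{f, h} \<subseteq> J"
      and u: "Poly_Mapping.keys u \<subseteq> {1..3}" and v: "Poly_Mapping.keys v \<subseteq> {1..3}"
      and deg: "wdeg d u = wdeg d v"
    have reduce: "\<exists>\<alpha> \<gamma>. mono_cong J u (?single 2 (Poly_Mapping.lookup u 2 mod t) + (?single 1 \<alpha> + ?single 3 \<gamma>)) \<and>
        wdeg d u = (Poly_Mapping.lookup u 2 mod t) * d 2 + (\<alpha> * d 1 + \<gamma> * d 3)"
      if u: "Poly_Mapping.keys u \<subseteq> {1..3}" for u
    proof -
      define k b where "k = Poly_Mapping.lookup u 2 div t" and "b = Poly_Mapping.lookup u 2 mod t"
      have kb: "Poly_Mapping.lookup u 2 = k * t + b" by (simp add: k_def b_def)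
      let ?w = "?single 2 b + (?single 1 (Poly_Mapping.lookup u 1) + ?single 3 (Poly_Mapping.lookup u 3))"
      have three: "{1..3} = {1, 2, 3::nat}" by auto
      have "u = ?single 1 (Poly_Mapping.lookup u 1) + ?single 2 (Poly_Mapping.lookup u 2) + ?single 3 (Poly_Mapping.lookup u 3)"
        using poly_mapping_expand_superset[OF _ u] unfolding three by (simp add: add.assoc)
      then have u_eq: "u = ?w + ?single 2 (k * t)"
        unfolding kb single_add by (simp add: ac_simps)
      have "mono_cong J (?single 2 t) (?single 1 r + ?single 3 s)"
        using sub by (simp add: f_def mono_cong_def)
      then have "mono_cong J (?single 2 (k * t)) (?single 1 (k * r) + ?single 3 (k * s))"
        by (intro mono_cong_mult[OF J] in3)
      then have "mono_cong J (?w + ?single 2 (k * t)) (?w + (?single 1 (k * r) + ?single 3 (k * s)))"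
        by (intro mono_cong_add_left[OF J] keys_add_subset keys_single_subset in3)
      then have "mono_cong J u (?single 2 b + (?single 1 (Poly_Mapping.lookup u 1 + k * r) + ?single 3 (Poly_Mapping.lookup u 3 + k * s)))"
        unfolding u_eq[symmetric] by (simp add: single_add ac_simps)
      moreover have "wdeg d u = b * d 2 + ((Poly_Mapping.lookup u 1 + k * r) * d 1 + (Poly_Mapping.lookup u 3 + k * s) * d 3)"
      proof -
        have "wdeg d u = wdeg d ?w + k * (t * d 2)"
          by (subst u_eq) (simp add: wdeg_add)
        then show ?thesis unfolding t(4) by (simp add: wdeg_add algebra_simps)
      qed
      ultimately show ?thesis unfolding b_def by blast
    qed
    obtain \<alpha> \<gamma> where u': "mono_cong J u (?single 2 (Poly_Mapping.lookup u 2 mod t) + (?single 1 \<alpha> + ?single 3 \<gamma>))"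
        "wdeg d u = (Poly_Mapping.lookup u 2 mod t) * d 2 + (\<alpha> * d 1 + \<gamma> * d 3)"
      using reduce[OF u] by blast
    obtain \<alpha>' \<gamma>' where v': "mono_cong J v (?single 2 (Poly_Mapping.lookup v 2 mod t) + (?single 1 \<alpha>' + ?single 3 \<gamma>'))"
        "wdeg d v = (Poly_Mapping.lookup v 2 mod t) * d 2 + (\<alpha>' * d 1 + \<gamma>' * d 3)"
      using reduce[OF v] by blast
    have mod: "(x * d 2 + (y * d 1 + z * d 3)) mod t = x * d 2 mod t" for x y z
    proof -
      have "t dvd y * d 1 + z * d 3" using t by simp
      then show ?thesis by (auto elim!: dvdE)
    qed
    have "(Poly_Mapping.lookup u 2 mod t) * d 2 mod t = (Poly_Mapping.lookup v 2 mod t) * d 2 mod t"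
      using deg u'(2) v'(2) mod by metis
    then have "[Poly_Mapping.lookup u 2 mod t * d 2 = Poly_Mapping.lookup v 2 mod t * d 2] (mod t)"
      by (simp add: cong_def)
    then have "[Poly_Mapping.lookup u 2 mod t = Poly_Mapping.lookup v 2 mod t] (mod t)"
      using t(3) by (simp add: cong_mult_rcancel_nat coprime_commute)
    then have b: "Poly_Mapping.lookup u 2 mod t = Poly_Mapping.lookup v 2 mod t"
      by (simp add: cong_def)
    then have "\<alpha> * d 1 + \<gamma> * d 3 = \<alpha>' * d 1 + \<gamma>' * d 3"
      using deg u'(2) v'(2) by simp
    moreover have "mono_cong J (?single 1 (d 3 div gcd (d 1) (d 3))) (?single 3 (d 1 div gcd (d 1) (d 3)))"
      using sub by (simp add: h_def mono_cong_def g_def)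
    ultimately have "mono_cong J (?single 1 \<alpha> + ?single 3 \<gamma>) (?single 1 \<alpha>' + ?single 3 \<gamma>')"
      using mono_cong_two_variables[OF J in3(1,3) pos[OF in3(1)] pos[OF in3(3)]] by blast
    then have "mono_cong J (?single 2 (Poly_Mapping.lookup u 2 mod t) + (?single 1 \<alpha> + ?single 3 \<gamma>))
        (?single 2 (Poly_Mapping.lookup v 2 mod t) + (?single 1 \<alpha>' + ?single 3 \<gamma>'))"
      unfolding b by (intro mono_cong_add_left[OF J] keys_single_subset in3)
    then show "mono_cong J u v"
      by (intro mono_cong_trans[OF J u'(1) mono_cong_trans[OF J _ mono_cong_sym[OF J v'(1)]]])
  qed
qed

text \<open>After division by the gcd, \<open>x'\<close> and \<open>y'\<close> are coprime and
  \<open>x' * y' \<le> N'\<close>. Choosing \<open>v < x'\<close> with \<open>v * y'\<close>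
  congruent to \<open>N'\<close> modulo \<open>x'\<close> gives \<open>v * y' \<le> N'\<close>, so
  the difference is a nonnegative multiple of \<open>x'\<close>.\<close>

lemma nat_combination_exists:
  fixes x y N :: nat
  assumes "0 < x" "0 < y" "gcd x y dvd N" "x * y \<le> gcd x y * N"
  shows "\<exists>u v. N = u * x + v * y"
proof -
  define g where "g = gcd x y"
  define x' y' where "x' = x div g" and "y' = y div g"
  have "g > 0" using assms by (simp add: g_def)
  have xy: "x = g * x'" "y = g * y'" by (simp_all add: g_def x'_def y'_def)
  have "coprime y' x'"
    unfolding x'_def y'_def g_def gcd.commute[of x y] using assms by (intro div_gcd_coprime) auto
  obtain N' where N: "N = g * N'" using assms(3) unfolding g_def[symmetric] ..
  have "g * g * (x' * y') \<le> g * g * N'"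
    using assms(4) unfolding g_def[symmetric] unfolding N xy by (simp add: ac_simps)
  then have le: "x' * y' \<le> N'" using \<open>g > 0\<close> by simp
  have "x' > 0" using xy(1) assms(1) by (cases x') auto
  obtain w where w: "[y' * w = Suc 0] (mod x')"
    using cong_solve_coprime_nat[OF \<open>coprime y' x'\<close>] by blast
  define v where "v = (w * N') mod x'"
  have "[y' * v = y' * w * N'] (mod x')"
    unfolding v_def cong_def by (simp add: mod_mult_right_eq mult.assoc)
  also have "[y' * w * N' = Suc 0 * N'] (mod x')" using w by (rule cong_scalar_right)
  finally have cong: "[N' = v * y'] (mod x')" by (simp add: cong_sym mult.commute)
  have "v \<le> x'" using \<open>x' > 0\<close> by (simp add: v_def less_imp_le)
  then have "v * y' \<le> N'" using le by (meson le_trans mult_le_mono1)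
  then have "x' dvd N' - v * y'" using cong by (simp add: cong_altdef_nat)
  then obtain u where "N' - v * y' = x' * u" ..
  then have "N' = u * x' + v * y'" using \<open>v * y' \<le> N'\<close> by (simp add: mult.commute)
  then have "N = u * x + v * y" unfolding N xy by (simp add: algebra_simps)
  then show ?thesis by blast
qed

section \<open>Critical degrees of a complete intersection\<close>

text \<open>Minimality of \<open>mi\<close> and \<open>mj\<close> is passed on in a form in which
  any explicit monomial of degree \<open>k * d i\<close> or \<open>k * d j\<close> gives a
  bound.\<close>

lemma toric_complete_intersection_equal_degrees:
  fixes d :: "nat \<Rightarrow> nat"
  assumes ci: "toric_complete_intersection n (toric_ideal n d :: 'k::field mpoly set)"
    and "2 \<le> n" and pos: "\<And>i. i \<in> {1..n} \<Longrightarrow> 0 < d i"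
  obtains i j mi mj where "1 \<le> i" "i < j" "j \<le> n" "0 < mi" "0 < mj" "mi * d i = mj * d j"
    "\<And>k u. 0 < k \<Longrightarrow> Poly_Mapping.keys u \<subseteq> {1..n} - {i} \<Longrightarrow> wdeg d u = k * d i \<Longrightarrow> mi \<le> k"
    "\<And>k u. 0 < k \<Longrightarrow> Poly_Mapping.keys u \<subseteq> {1..n} - {j} \<Longrightarrow> wdeg d u = k * d j \<Longrightarrow> mj \<le> k"
proof -
  define rep where "rep i k \<longleftrightarrow> 0 < k \<and> (\<exists>u. Poly_Mapping.keys u \<subseteq> {1..n} - {i} \<and> wdeg d u = k * d i)" for i k
  define m where "m i = (LEAST k. rep i k)" for i
  have rep: "rep i (m i)" if i: "i \<in> {1..n}" for i
  proof -
    obtain j where j: "j \<in> {1..n} - {i}" using \<open>2 \<le> n\<close> that[of 1] that[of 2] by (cases "i = 1") auto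
    \<comment> \<open>The least multiple exists: \<open>x_j^(d i)\<close> has degree
      \<open>d j * d i\<close>.\<close>
    have "rep i (d j)" unfolding rep_def
      using j pos by (intro conjI exI[of _ "Poly_Mapping.single j (d i)"] keys_single_subset) auto
    then show ?thesis unfolding m_def by (rule LeastI)
  qed
  have least: "m i \<le> k" if "0 < k" "Poly_Mapping.keys u \<subseteq> {1..n} - {i}" "wdeg d u = k * d i" for i k u
    unfolding m_def by (rule Least_le) (use that in \<open>auto simp: rep_def\<close>)
  have "\<exists>w. i \<in> {1..n} \<longrightarrow> Poly_Mapping.keys w \<subseteq> {1..n} - {i} \<and> wdeg d w = m i * d i" for i
    using rep[of i] unfolding rep_def by blast
  then have "\<exists>w. \<forall>i. i \<in> {1..n} \<longrightarrow> Poly_Mapping.keys (w i) \<subseteq> {1..n} - {i} \<and> wdeg d (w i) = m i * d i"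
    by (intro choice allI)
  then obtain w where w: "Poly_Mapping.keys (w i) \<subseteq> {1..n} - {i}" "wdeg d (w i) = m i * d i"
    if "i \<in> {1..n}" for i
    by blast
  have "\<not> inj_on (\<lambda>i. m i * d i) {1..n}"
  proof
    assume inj: "inj_on (\<lambda>i. m i * d i) {1..n}"
    have "enat n \<le> min_num_generators (mpoly_ring n) (toric_ideal n d :: 'k mpoly set)"
    proof (rule toric_min_num_generators_ge_powers[OF pos w _ _ inj])
      show "wdeg d u \<noteq> k * d i" if "0 < k" "k < m i" "Poly_Mapping.keys u \<subseteq> {1..n} - {i}" for i k u
        using least[OF that(1,3)] that(2) by (meson not_le)
      show "0 < m i" if "i \<in> {1..n}" for i using rep[OF that] by (simp add: rep_def)
    qed
    then show False using ci \<open>2 \<le> n\<close> by (simp add: toric_complete_intersection_def)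
  qed
  then obtain i j where "i \<in> {1..n}" "j \<in> {1..n}" "i < j" "m i * d i = m j * d j"
    unfolding inj_on_def by (metis linorder_neqE_nat)
  then show ?thesis
    using that[of i j "m i" "m j"] least rep by (simp add: rep_def)
qed

subsection \<open>Lucas sequences\<close>

context
  fixes p q :: nat
  assumes p: "p > 0" and q: "q > 0"
begin

abbreviation (input) L where "L \<equiv> lucas p q"

lemma lucas_pos: "L n > 0"
  using p q by (induction n rule: induct_nat_012) auto

text \<open>With \<open>\<alpha>\<close>, \<open>\<beta>\<close> the roots of
  \<open>x^2 = p * x + q\<close>, this expands the product of \<open>\<alpha>^k + \<beta>^k\<close>
  and \<open>\<alpha>^(m + k) + \<beta>^(m + k)\<close>, using
  \<open>\<alpha> * \<beta> = - q\<close>. The induction uses the shifts \<open>m + 1\<close> and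
  \<open>m + 2\<close>.\<close>

lemma lucas_add_int: "int (L (m + 2 * k)) = int (L k) * int (L (m + k)) - (- int q) ^ k * int (L m)"
proof (induction k arbitrary: m rule: induct_nat_012)
  case (ge2 k)
  have "int (L (Suc (Suc k))) * int (L (m + Suc (Suc k))) =
      int p * (int (L (Suc k)) * int (L (Suc m + Suc k))) + int q * (int (L k) * int (L (m + 2 + k)))"
    by (simp add: algebra_simps)
  also have "\<dots> = int p * (int (L (Suc m + 2 * Suc k)) + (- int q) ^ Suc k * int (L (Suc m)))
      + int q * (int (L (m + 2 + 2 * k)) + (- int q) ^ k * int (L (m + 2)))"
    using ge2(1)[of "m + 2"] ge2(2)[of "Suc m"] by simp
  also have "\<dots> = int (L (m + 2 * Suc (Suc k))) + (- int q) ^ Suc (Suc k) * int (L m)"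
    by (simp add: algebra_simps)
  finally show ?case by simp
qed simp_all

text \<open>The addition formula with \<open>k = t\<close> and \<open>m = s - t\<close>; fixing the
  parity of \<open>t\<close> resolves the sign, so it can be read in the naturals.\<close>

lemma lucas_mult_odd:
  assumes "odd t" "t \<le> s"
  shows "L (s + t) = L s * L t + q ^ t * L (s - t)"
proof -
  have "int (L (s + t)) = int (L s * L t + q ^ t * L (s - t))"
    using lucas_add_int[of "s - t" t] assms by (simp add: algebra_simps mult_2)
  then show ?thesis by linarith
qed

lemma lucas_mult_even:
  assumes "even t" "t \<le> s"
  shows "L s * L t = L (s + t) + q ^ t * L (s - t)"
proof -
  have "int (L s * L t) = int (L (s + t) + q ^ t * L (s - t))"
    using lucas_add_int[of "s - t" t] assms by (simp add: algebra_simps mult_2)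
  then show ?thesis by linarith
qed

section \<open>Growth of the sequence\<close>

text \<open>Index 0 is excluded because \<open>L 0 = 2\<close>, while \<open>L 1 = p\<close> may be
  1.\<close>

lemma lucas_less_Suc: "n > 0 \<Longrightarrow> L n < L (Suc n)"
proof (induction n rule: induct_nat_012)
  case 1
  have "p \<le> p * p" "0 < q * 2" using p q by simp_all
  then show ?case unfolding One_nat_def lucas.simps by linarith
next
  case (ge2 n)
  have "L (Suc (Suc n)) \<le> p * L (Suc (Suc n))" "0 < q * L (Suc n)"
    using p q lucas_pos by simp_all
  then show ?case unfolding lucas.simps(3)[of p q "Suc n"] by linarith
qed simp

lemma lucas_less: "0 < m \<Longrightarrow> m < n \<Longrightarrow> L m < L n"
proof (induction n)
  case (Suc n)
  then show ?case using lucas_less_Suc[of n] by (cases "m = n") auto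
qed simp

lemma lucas_le: "0 < m \<Longrightarrow> m \<le> n \<Longrightarrow> L m \<le> L n"
  using lucas_less[of m n] by (cases "m = n") auto

lemma lucas_add2_ge: "L (Suc n) + L n \<le> L (Suc (Suc n))"
proof -
  have "L (Suc n) \<le> p * L (Suc n)" "L n \<le> q * L n" using p q by simp_all
  then show ?thesis unfolding lucas.simps by (rule add_mono)
qed

lemma lucas_double_le: "0 < m \<Longrightarrow> m + 2 \<le> n \<Longrightarrow> 2 * L m \<le> L n"
  using lucas_add2_ge[of m] lucas_less_Suc[of m] lucas_le[of "m + 2" n] by auto

lemma lucas_power_le: "q ^ k * L m \<le> L (m + 2 * k)"
proof (induction k)
  case (Suc k)
  have "q ^ Suc k * L m \<le> q * L (m + 2 * k)" using Suc by simp
  also have "\<dots> \<le> L (m + 2 * Suc k)" by simp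
  finally show ?case .
qed simp

text \<open>The product exceeds \<open>L (s + t)\<close> by at most
  \<open>q ^ t * L (s - t)\<close>, which is itself at most \<open>L (s + t)\<close>.\<close>

lemma lucas_mult_le: "L s * L t \<le> 2 * L (s + t)"
proof -
  have *: "L s * L t \<le> 2 * L (s + t)" if "t \<le> s" for s t
  proof (cases "even t")
    case True
    have "q ^ t * L (s - t) \<le> L (s + t)" using lucas_power_le[of t "s - t"] that by (simp add: mult_2)
    then show ?thesis using lucas_mult_even[OF True that] by linarith
  next
    case False
    then show ?thesis using lucas_mult_odd[OF False that] by linarith
  qed
  show ?thesis using *[of t s] *[of s t] by (cases "t \<le> s") (auto simp: mult.commute add.commute)
qed

section \<open>Divisibility and parity\<close>

lemma lucas_dvd_odd_mult: "odd k \<Longrightarrow> L g dvd L (g * k)"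
proof (induction k rule: induct_nat_012)
  case (ge2 k)
  have "int (L g) dvd int (L (g * k + 2 * g))"
    unfolding lucas_add_int using ge2 by simp
  then have "L g dvd L (g * k + 2 * g)" by simp
  moreover have "g * k + 2 * g = g * Suc (Suc k)" by simp
  ultimately show ?case by (simp only:)
qed auto

lemma lucas_even: "even p \<Longrightarrow> even (L n)"
  by (induction n rule: induct_nat_012) auto

lemma lucas_odd: "odd p \<Longrightarrow> even q \<Longrightarrow> n > 0 \<Longrightarrow> odd (L n)"
  by (induction n rule: induct_nat_012) auto

lemma lucas_even_iff:
  assumes "odd p" "odd q"
  shows "even (L n) \<longleftrightarrow> 3 dvd n"
proof -
  \<comment> \<open>Modulo 2 this is the Fibonacci recurrence, with period even, odd, odd.\<close>
  have step: "even (L (k + 3)) \<longleftrightarrow> even (L k)" for k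
    using assms by (simp add: numeral_3_eq_3) argo
  show ?thesis
  proof (induction n rule: less_induct)
    case (less n)
    consider "n = 0" | "n = 1" | "n = 2" | k where "n = k + 3"
      using that(4)[of "n - 3"] by (cases "n < 3") (auto simp: numeral_3_eq_3 less_Suc_eq numeral_2_eq_2)
    then show ?case
    proof cases
      case 4
      then show ?thesis using less[of k] step[of k] by simp
    next
      case 3
      have "L 2 = p * p + q * 2" by (simp add: numeral_2_eq_2)
      then show ?thesis using 3 assms by simp
    qed (use assms in simp_all)
  qed
qed

section \<open>Estimates for products\<close>

lemma lucas_square_less:
  assumes "even d" "0 < d"
  shows "L d * L d < L (3 * d)"
proof -
  obtain w where w: "d = 2 * w" using assms by (auto elim: evenE)
  have "L d * L d = L (2 * d) + q ^ d * 2" using lucas_mult_even[of d d] assms by (simp add: mult_2)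
  also have "\<dots> \<le> L (2 * d) + L (2 * d)" using lucas_power_le[of d 0] by simp
  also have "\<dots> < L (Suc (2 * d)) + L (2 * d)" using lucas_less_Suc[of "2 * d"] assms by simp
  also have "\<dots> \<le> L (Suc (Suc (2 * d)))" by (rule lucas_add2_ge)
  also have "\<dots> \<le> L (3 * d)" using w assms by (intro lucas_le) auto
  finally show ?thesis .
qed

text \<open>An equality for even \<open>a\<close>; for odd \<open>a\<close> the correction term is
  subtracted instead.\<close>

lemma lucas_mult_add_le: "L a * L (a + d) \<le> L (2 * a + d) + q ^ a * L d"
proof -
  have e: "a + d + a = 2 * a + d" "a + d - a = d" by simp_all
  show ?thesis
    using lucas_mult_odd[of a "a + d", unfolded e] lucas_mult_even[of a "a + d", unfolded e]
    by (cases "even a") (simp_all add: mult.commute[of "L a"])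
qed

text \<open>The correction \<open>q ^ a * L d\<close> is at most
  \<open>q * L (2 * a + d - 1)\<close>, so the recurrence bounds the product by
  \<open>L (2 * a + d + 1)\<close>.\<close>

lemma lucas_mult_le_add:
  assumes "0 < a" "0 < d" "2 * a + d < t"
  shows "L a * L (a + d) \<le> L t"
proof -
  have le: "q ^ a * L d \<le> q * L (2 * a + d - 1)"
  proof -
    have "q ^ a * L d \<le> q ^ a * L (d + 1)" using lucas_le[of d "d + 1"] assms by simp
    also have "\<dots> = q * (q ^ (a - 1) * L (d + 1))" using assms by (cases a) auto
    also have "\<dots> \<le> q * L (d + 1 + 2 * (a - 1))" by (intro mult_le_mono2 lucas_power_le)
    also have "d + 1 + 2 * (a - 1) = 2 * a + d - 1" using assms by simp
    finally show ?thesis .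
  qed
  have "L a * L (a + d) \<le> L (2 * a + d) + q ^ a * L d" by (rule lucas_mult_add_le)
  also have "\<dots> \<le> p * L (2 * a + d) + q * L (2 * a + d - 1)"
    using p le by (intro add_mono) auto
  also have "\<dots> = L (Suc (2 * a + d))" using assms lucas.simps(3)[of p q "2 * a + d - 1"] by simp
  also have "\<dots> \<le> L t" using assms by (intro lucas_le) auto
  finally show ?thesis .
qed

text \<open>Since \<open>a = d + g\<close>, the correction is at most
  \<open>q ^ g * L (3 * d)\<close>. As \<open>a + 2 * d + g = 2 * a + d\<close> and
  \<open>a + 2 * d - g = 3 * d\<close>, the bound is exactly
  \<open>L (a + 2 * d) * L g\<close>.\<close>

lemma lucas_mult_le_mult:
  assumes "even g" "0 < g" "a = d + g" "a + 2 * d \<le> t" "0 < d"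
  shows "L a * L (a + d) \<le> L g * L t"
proof -
  have "L a * L (a + d) \<le> L (2 * a + d) + q ^ a * L d" by (rule lucas_mult_add_le)
  also have "\<dots> = L (2 * a + d) + q ^ g * (q ^ d * L d)"
    using assms by (simp add: power_add)
  also have "\<dots> \<le> L (2 * a + d) + q ^ g * L (d + 2 * d)"
    by (intro add_mono mult_le_mono2 lucas_power_le) auto
  also have "\<dots> = L (a + 2 * d) * L g"
    using lucas_mult_even[of g "a + 2 * d"] assms by (simp add: algebra_simps mult_2)
  also have "\<dots> \<le> L t * L g" using assms by (intro mult_le_mono1 lucas_le) auto
  finally show ?thesis by (simp add: mult.commute)
qed

section \<open>Greatest common divisors of Lucas numbers\<close>

context
  assumes coprime_pq: "coprime p q"
begin

lemma coprime_lucas_q: "n > 0 \<Longrightarrow> coprime (L n) q"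
proof (induction n rule: induct_nat_012)
  case (ge2 n)
  then have "coprime (p * L (Suc n)) q" using coprime_pq by simp
  moreover have "gcd (L (Suc (Suc n))) q = gcd (p * L (Suc n)) q"
    using gcd_add_mult[of q "L n" "p * L (Suc n)"] by (simp add: gcd.commute add.commute mult.commute)
  ultimately show ?case by (simp only: coprime_iff_gcd_eq_1)
qed (use coprime_pq in auto)

text \<open>The addition formula reduces \<open>L n\<close> modulo \<open>L m\<close>;
  \<open>q\<close> is invertible modulo \<open>L m\<close>, so the power of \<open>q\<close> drops
  out of the gcd.\<close>

lemma gcd_lucas_reflect:
  assumes "0 < m" "m < n"
  shows "gcd (L n) (L m) = gcd (L (if 2 * m \<le> n then n - 2 * m else 2 * m - n)) (L m)"
proof -
  have red: "gcd (x * y - u ^ k * w) x = gcd w x" if "coprime u x" for x y u w :: int and k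
  proof -
    have "gcd (x * y - u ^ k * w) x = gcd (u ^ k * w) x"
    proof (rule gcdI[symmetric])
      show "gcd (u ^ k * w) x dvd x * y - u ^ k * w"
        by (intro dvd_diff dvd_mult2 gcd_dvd1 gcd_dvd2)
      show "e dvd gcd (u ^ k * w) x" if "e dvd x * y - u ^ k * w" "e dvd x" for e
        using dvd_diff[OF dvd_mult2[OF that(2), of y] that(1)] that(2) by simp
    qed simp_all
    also have "\<dots> = gcd w x"
      using that by (simp add: gcd_mult_left_left_cancel coprime_commute)
    finally show ?thesis .
  qed
  have cop: "coprime (- int q) (int (L m))"
    using coprime_lucas_q[OF assms(1)] by (simp add: coprime_commute)
  show ?thesis
  proof (cases "2 * m \<le> n")
    case True
    have "int (L n) = int (L m) * int (L (n - m)) - (- int q) ^ m * int (L (n - 2 * m))"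
      using lucas_add_int[of "n - 2 * m" m] True by simp
    then have "gcd (int (L n)) (int (L m)) = gcd (int (L (n - 2 * m))) (int (L m))"
      using red[OF cop] by simp
    then show ?thesis using True by simp
  next
    case False
    have "int (L n) = int (L m) * int (L (n - m)) - (- int q) ^ (n - m) * int (L (2 * m - n))"
    proof -
      have e: "2 * m - n + 2 * (n - m) = n" "2 * m - n + (n - m) = m" using False assms by linarith+
      show ?thesis using lucas_add_int[of "2 * m - n" "n - m", unfolded e] by (simp only: mult.commute)
    qed
    then have "gcd (int (L n)) (int (L m)) = gcd (int (L (2 * m - n))) (int (L m))"
      using red[OF cop] by simp
    then show ?thesis using False by simp
  qed
qed

text \<open>The Euclidean step \<open>(m, n) \<mapsto> (m, \<bar>n - 2 * m\<bar>)\<close> preserves the common divisors with odd quotients.\<close>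

lemma gcd_lucas:
  "gcd (L m) (L n) dvd 2 \<and> \<not> (odd m \<and> odd n) \<or>
   (\<exists>g r s. m = g * r \<and> n = g * s \<and> odd r \<and> odd s \<and> gcd (L m) (L n) = L g)"
proof -
  define P where "P = (\<lambda>m n. gcd (L m) (L n) dvd 2 \<and> \<not> (odd m \<and> odd n) \<or>
   (\<exists>g r s. m = g * r \<and> n = g * s \<and> odd r \<and> odd s \<and> gcd (L m) (L n) = L g))"
  have sym: "P n m" if "P m n" for m n
    using that unfolding P_def gcd.commute[of "L n" "L m"] by blast
  have main: "P n m" if "m \<le> n" "\<And>m' n'. m' + n' < m + n \<Longrightarrow> P m' n'" for m n
  proof -
    consider "m = 0" | "m = n" | "0 < m" "m < n" using \<open>m \<le> n\<close> by linarith
    then show ?thesis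
    proof cases
      \<comment> \<open>Here \<open>L 0 = 2\<close>, so the gcd divides 2.\<close>
      case 1
      then show ?thesis by (simp add: P_def)
    next
      case 2
      then show ?thesis unfolding P_def by (intro disjI2 exI[of _ m] exI[of _ 1]) simp
    next
      case 3
      define n' where "n' = (if 2 * m \<le> n then n - 2 * m else 2 * m - n)"
      have gcd: "gcd (L n) (L m) = gcd (L n') (L m)"
        unfolding n'_def by (rule gcd_lucas_reflect) (use 3 in auto)
      have "n' + m < m + n" using 3 by (auto simp: n'_def)
      from that(2)[OF this] show ?thesis unfolding P_def
      proof (elim disjE)
        assume "gcd (L n') (L m) dvd 2 \<and> \<not> (odd n' \<and> odd m)"
        moreover have "odd n' \<longleftrightarrow> odd n" using 3 by (auto simp: n'_def)
        ultimately show "gcd (L n) (L m) dvd 2 \<and> \<not> (odd n \<and> odd m) \<or>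
   (\<exists>g r s. n = g * r \<and> m = g * s \<and> odd r \<and> odd s \<and> gcd (L n) (L m) = L g)" using gcd by simp
      next
        assume "\<exists>g r s. n' = g * r \<and> m = g * s \<and> odd r \<and> odd s \<and> gcd (L n') (L m) = L g"
        then obtain g r s where g: "n' = g * r" "m = g * s" "odd r" "odd s" "gcd (L n') (L m) = L g"
          by blast
        \<comment> \<open>The quotient is \<open>r + 2 * s\<close> or \<open>2 * s - r\<close>, odd
          in both cases.\<close>
        obtain t where t: "n = g * t" "odd t"
        proof (cases "2 * m \<le> n")
          case True
          then have "n = g * (r + 2 * s)" using g(1,2) by (simp add: n'_def algebra_simps)
          then show ?thesis using g by (intro that[of "r + 2 * s"]) simp_all
        next
          case False
          then have n: "n + g * r = g * (2 * s)" using g(1,2) by (simp add: n'_def)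
          then have "n = g * (2 * s - r)" by (simp add: diff_mult_distrib2)
          moreover have "r < 2 * s"
          proof -
            have "g * r < g * (2 * s)" using n 3 by linarith
            then show ?thesis by simp
          qed
          ultimately show ?thesis using g by (intro that[of "2 * s - r"]) simp_all
        qed
        then show "gcd (L n) (L m) dvd 2 \<and> \<not> (odd n \<and> odd m) \<or>
          (\<exists>g r s. n = g * r \<and> m = g * s \<and> odd r \<and> odd s \<and> gcd (L n) (L m) = L g)"
          using g t gcd by (intro disjI2 exI[of _ g] exI[of _ t] exI[of _ s]) simp
      qed
    qed
  qed
  have "P m n"
  proof (induction "m + n" arbitrary: m n rule: less_induct)
    case less
    show ?case
    proof (cases "m \<le> n")
      case True
      show ?thesis by (rule sym, rule main[OF True], rule less)
    next
      case False
      show ?thesis by (rule main) (use False less in auto)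
    qed
  qed
  then show ?thesis unfolding P_def .
qed

lemma gcd_lucas_cases:
  obtains "gcd (L m) (L n) \<le> 2" "\<not> (odd m \<and> odd n)"
  | g r s where "m = g * r" "n = g * s" "odd r" "odd s" "gcd (L m) (L n) = L g"
  using gcd_lucas[of m n] dvd_imp_le[of "gcd (L m) (L n)" 2] by auto

text \<open>If the gcd is \<open>L g\<close>, then \<open>t\<close> is an odd multiple of
  \<open>g\<close> other than \<open>g\<close> itself, so \<open>3 * g \<le> t\<close>. Together
  with \<open>3 * d < t\<close> this leaves room for \<open>d + g + 2 < t\<close>, which absorbs the
  factor 2 in the product estimate.\<close>

lemma lucas_mult_gcd_less:
  assumes "even d" "0 < d" "0 < s" "s < t" "3 * d < t"
  shows "L d * gcd (L s) (L t) < L t"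
proof (cases rule: gcd_lucas_cases[of s t])
  case 1
  have "L d * gcd (L s) (L t) \<le> 2 * L d" using 1 by simp
  also have "\<dots> \<le> L (d + 2)" using assms by (intro lucas_double_le) auto
  also have "\<dots> < L t" using assms by (intro lucas_less) auto
  finally show ?thesis .
next
  case (2 g u v)
  have "g > 0" using 2 assms by (cases g) auto
  have "v \<noteq> 1" using 2 assms by (cases u) auto
  then have "3 \<le> v" using \<open>odd v\<close> by (cases v) (auto elim!: oddE)
  obtain w where w: "d = 2 * w" using assms by (auto elim: evenE)
  have "g * 3 \<le> t" "d = 2 * w" using 2 w \<open>3 \<le> v\<close> by simp_all
  moreover have "1 \<le> w" using w assms by linarith
  ultimately have t: "d + g + 2 < t" using assms by linarith
  have "L d * gcd (L s) (L t) \<le> 2 * L (d + g)" using 2 lucas_mult_le[of d g] by simp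
  also have "\<dots> \<le> L (d + g + 2)" using assms by (intro lucas_double_le) auto
  also have "\<dots> < L t" using assms t by (intro lucas_less) auto
  finally show ?thesis .
qed

text \<open>Write the gcd as \<open>L g\<close> with \<open>a = g * r\<close>,
  \<open>d = g * k\<close>, \<open>k < r\<close>. The product estimate settles odd \<open>g\<close>,
  and also even \<open>g\<close> with \<open>r \<ge> k + 3\<close>. As \<open>r\<close> is odd and
  \<open>k\<close> even, only \<open>r = k + 1\<close> with even \<open>g\<close> is left, and this
  is the excluded condition on \<open>gcd a d\<close> and the valuations.\<close>

lemma lucas_mult_gcd_le:
  assumes "even d" "0 < d" "d < a"
    and "\<not> (int (gcd a d) = int a - int d \<and> multiplicity 2 d > multiplicity 2 a \<and> multiplicity 2 a \<ge> 1)"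
  shows "L d * gcd (L a) (L (a + d)) \<le> L a"
proof (cases rule: gcd_lucas_cases[of a "a + d"])
  case 1
  then have "even a" using assms by auto
  then have "d + 2 \<le> a" using assms by presburger
  have "L d * gcd (L a) (L (a + d)) \<le> 2 * L d" using 1 by simp
  also have "\<dots> \<le> L a" using assms \<open>d + 2 \<le> a\<close> by (intro lucas_double_le) auto
  finally show ?thesis .
next
  case (2 g r s)
  have "g > 0" using 2 assms by (cases g) auto
  have d: "d = g * (s - r)" using 2(1,2) by (simp add: diff_mult_distrib2)
  have "r < s" using 2(1,2) assms by (metis \<open>0 < g\<close> less_add_same_cancel1 mult_less_cancel1)
  define k where "k = s - r"
  have k: "d = g * k" "even k" "0 < k" using d 2 \<open>r < s\<close> by (auto simp: k_def)
  have "k < r" using 2(1) k(1) assms by simp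
  have kr: "k + 1 \<le> r" using \<open>k < r\<close> by simp
  have "g * 1 \<le> d" using k by simp
  have "g * (k + 1) \<le> a" unfolding 2(1) using kr by (rule mult_le_mono2)
  then have dg: "d + g \<le> a" using k by simp
  show ?thesis
  proof (cases "odd g")
    case True
    have "L d * L g \<le> L (d + g)" using lucas_mult_odd[OF True, of d] \<open>g * 1 \<le> d\<close> by simp
    also have "\<dots> \<le> L a" using dg assms by (intro lucas_le) auto
    finally show ?thesis using 2 by simp
  next
    case False
    have "r \<noteq> k + 1"
    proof
      assume r: "r = k + 1"
      have "coprime (k + 1) k" by simp
      then have "gcd a d = g" using 2(1) k(1) r by (simp add: gcd_mult_left gcd_mult_distrib_nat[symmetric] coprime_iff_gcd_eq_1)
      moreover have "multiplicity 2 a = multiplicity 2 g"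
        using 2 \<open>g > 0\<close> by (simp add: prime_elem_multiplicity_mult_distrib not_dvd_imp_multiplicity_0 odd_pos)
      moreover have "multiplicity 2 d = multiplicity 2 g + multiplicity 2 k"
        using k \<open>g > 0\<close> by (simp add: prime_elem_multiplicity_mult_distrib)
      moreover have "multiplicity 2 k > 0" "multiplicity 2 g > 0"
        using k False \<open>g > 0\<close> by (simp_all add: multiplicity_gt_zero_iff)
      moreover have "int a - int d = int g" using 2(1) k(1) r by (simp add: algebra_simps)
      ultimately show False using assms(4) by linarith
    qed
    then have "k + 2 \<le> r" using kr by simp
    moreover have "r \<noteq> k + 2" using 2 k by auto
    ultimately have "g * (k + 3) \<le> a" unfolding 2(1) by (intro mult_le_mono2) simp
    moreover have "2 \<le> g" using False \<open>g > 0\<close> by presburger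
    ultimately have a: "d + g + 2 \<le> a" using k by (simp add: algebra_simps)
    have "L d * L g \<le> 2 * L (d + g)" by (rule lucas_mult_le)
    also have "\<dots> \<le> L a" using a assms by (intro lucas_double_le) auto
    finally show ?thesis using 2 by simp
  qed
qed

text \<open>With gcd \<open>L g\<close> and \<open>e * d = f + d\<close>, the product
  \<open>L (a + d) * L g\<close> is at most \<open>L (a + e * d)\<close> if
  \<open>g \<le> f\<close>, with room of 2 for even \<open>g\<close>. This fails only for
  \<open>e = 2\<close> and \<open>g = d\<close>.\<close>

lemma gcd_lucas_mult_le:
  assumes "even d" "0 < d" "d < a" "2 \<le> e"
  obtains "gcd (L a) (L (a + e * d)) * L (a + d) \<le> L (a + e * d)"
  | "e = 2" "d dvd a" "odd (a div d)" "gcd (L a) (L (a + e * d)) = L d"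
proof (cases rule: gcd_lucas_cases[of a "a + e * d"])
  case 1
  obtain w where w: "d = 2 * w" using assms by (auto elim: evenE)
  have "2 * d \<le> e * d" using assms(4) by (rule mult_le_mono1)
  moreover have "1 \<le> w" using w \<open>0 < d\<close> by linarith
  ultimately have "a + d + 2 \<le> a + e * d" using w by linarith
  then have "2 * L (a + d) \<le> L (a + e * d)" using assms by (intro lucas_double_le) auto
  moreover have "gcd (L a) (L (a + e * d)) * L (a + d) \<le> 2 * L (a + d)" using 1 by simp
  ultimately show ?thesis using that(1) by linarith
next
  case (2 g r s)
  have "g > 0" using 2 assms by (cases g) auto
  have ed: "e * d = g * (s - r)" using 2(1,2) by (simp add: diff_mult_distrib2)
  define k where "k = s - r"
  have k: "e * d = g * k" "even k" using ed 2 by (auto simp: k_def)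
  have "k \<noteq> 0" using k assms by (intro notI) simp
  then have "2 \<le> k" using k by (auto elim!: evenE)
  then have gk: "g * 2 \<le> e * d" unfolding k by (rule mult_le_mono2)
  define f where "f = (e - 1) * d"
  have f: "e * d = f + d" "even f" using assms by (auto simp: f_def algebra_simps)
  show ?thesis
  proof (cases "e = 2 \<and> g = d")
    case True
    then have "e = 2" "d dvd a" "odd (a div d)" "gcd (L a) (L (a + e * d)) = L d"
      using 2 assms by auto
    then show ?thesis by (rule that(2))
  next
    case False
    \<comment> \<open>For \<open>g > d\<close> the bound \<open>2 * g \<le> e * d\<close> gives
      \<open>g < f\<close>; evenness of \<open>d\<close> and \<open>f\<close> supplies the
      additional 2.\<close>
    have fg: "g \<le> f \<and> (even g \<longrightarrow> g + 2 \<le> f)"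
    proof -
      consider "d < g" | "d = g" "3 \<le> e" | "g < d" using False assms by linarith
      then show ?thesis
      proof cases
        case 1
        then have "g < f" using gk f by linarith
        then show ?thesis using f by presburger
      next
        case 2
        then have "2 * d \<le> f" unfolding f_def by (intro mult_le_mono1) simp
        then show ?thesis using 2 assms by presburger
      next
        case 3
        have "1 * d \<le> f" unfolding f_def using assms by (intro mult_le_mono1) simp
        then show ?thesis using 3 assms by presburger
      qed
    qed
    have ga: "g \<le> a + d" using 2 assms by (cases r) auto
    have "L (a + d) * L g \<le> L (a + e * d)"
    proof (cases "odd g")
      case True
      have "L (a + d) * L g \<le> L (a + d + g)" using lucas_mult_odd[OF True ga] by simp
      also have "\<dots> \<le> L (a + e * d)" using fg f assms by (intro lucas_le) auto
      finally show ?thesis .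
    next
      case False
      have "L (a + d) * L g \<le> 2 * L (a + d + g)" by (rule lucas_mult_le)
      also have "\<dots> \<le> L (a + e * d)" using False fg f assms by (intro lucas_double_le) auto
      finally show ?thesis .
    qed
    then show ?thesis using 2 that(1) by (simp add: mult.commute)
  qed
qed

subsection \<open>Toric ideals of Lucas progressions\<close>

lemma lucas_step_even:
  assumes "even d"
  shows "L d * L (a + Suc i * d) = L (a + Suc (Suc i) * d) + q ^ d * L (a + i * d)"
  using lucas_mult_even[OF assms, of "a + Suc i * d"] by (simp add: algebra_simps)

lemma gcd_dvd_lucas_progression:
  assumes "even d"
  shows "gcd (L a) (L (a + d)) dvd L (a + i * d)"
proof (induction i rule: induct_nat_012)
  case (ge2 i)
  have "gcd (L a) (L (a + d)) dvd L (a + Suc (Suc i) * d) + q ^ d * L (a + i * d)"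
    unfolding lucas_step_even[OF assms, symmetric] using ge2 by simp
  then show ?case using ge2(1) by (simp only: dvd_add_left_iff dvd_mult)
qed simp_all

lemma lucas_progression_odd:
  assumes "odd d"
  shows "\<exists>u v. L (a + i * d) = u * L a + v * L (a + d)"
proof (induction i rule: induct_nat_012)
  case 0
  show ?case by (intro exI[of _ 1] exI[of _ 0]) simp
next
  case 1
  show ?case by (intro exI[of _ 0] exI[of _ 1]) simp
next
  case (ge2 i)
  then obtain u v u' v' where uv: "L (a + i * d) = u * L a + v * L (a + d)"
    "L (a + Suc i * d) = u' * L a + v' * L (a + d)" by blast
  have "L (a + Suc (Suc i) * d) = L d * L (a + Suc i * d) + q ^ d * L (a + i * d)"
    using lucas_mult_odd[OF assms, of "a + Suc i * d"] by (simp add: algebra_simps)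
  also have "\<dots> = (L d * u' + q ^ d * u) * L a + (L d * v' + q ^ d * v) * L (a + d)"
    unfolding uv by (simp add: algebra_simps)
  finally show ?case by blast
qed

lemma toric_complete_intersection_lucasI:
  assumes "3 \<le> n"
    and "\<And>i. 2 \<le> i \<Longrightarrow> \<exists>u v. L (a + i * d) = u * L a + v * L (a + d)"
  shows "toric_complete_intersection n (toric_ideal n (\<lambda>i. L (a + (i - 1) * d)) :: 'k::field mpoly set)"
proof (rule toric_complete_intersection_if_in_semigroup)
  show "\<exists>u v. L (a + (i - 1) * d) = u * L (a + (1 - 1) * d) + v * L (a + (2 - 1) * d)"
    if "i \<in> {3..n}" for i
  proof -
    have "2 \<le> i - 1" using that by auto
    from assms(2)[OF this] show ?thesis by simp
  qed
qed (use assms(1) lucas_pos in auto)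

lemma lucas_complete_intersection_le:
  assumes "0 < a" "0 < d" "even d" "a \<le> d" "3 \<le> n"
  shows "toric_complete_intersection n (toric_ideal n (\<lambda>i. L (a + (i - 1) * d)) :: 'k::field mpoly set)"
proof (rule toric_complete_intersection_lucasI[OF assms(5)])
  fix i :: nat assume i: "2 \<le> i"
  show "\<exists>u v. L (a + i * d) = u * L a + v * L (a + d)"
  proof (cases "i = 2 \<and> a = d")
    \<comment> \<open>The index is \<open>3 * a = 2 * a + d\<close>, just missing the strict bound
      needed below, but \<open>L a\<close> divides \<open>L (3 * a)\<close>.\<close>
    case True
    then have "L a dvd L (a + i * d)"
      using lucas_dvd_odd_mult[of 3 a] by (simp add: algebra_simps)
    then obtain k where "L (a + i * d) = L a * k" ..
    then show ?thesis by (intro exI[of _ k] exI[of _ 0]) (simp add: mult.commute)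
  next
    case False
    have "2 * a + d < a + i * d"
    proof (cases "a = d")
      case True
      then have "3 * d \<le> i * d" using False i by (intro mult_le_mono1) simp
      then show ?thesis using True assms by simp
    next
      case False
      have "2 * d \<le> i * d" using i by (rule mult_le_mono1)
      moreover have "a < d" using False assms by simp
      ultimately show ?thesis by linarith
    qed
    then have "L a * L (a + d) \<le> 1 * L (a + i * d)"
      using lucas_mult_le_add[OF assms(1,2)] by simp
    also have "\<dots> \<le> gcd (L a) (L (a + d)) * L (a + i * d)"
      using lucas_pos[of a] by (intro mult_le_mono1) (simp add: Suc_le_eq)
    finally show ?thesis
      by (intro nat_combination_exists gcd_dvd_lucas_progression assms lucas_pos)
  qed
qed

text \<open>Here \<open>a = d + g\<close> and \<open>d = g * s\<close>, with \<open>g\<close> even,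
  and with \<open>s\<close> even by the valuations. So \<open>a\<close> and \<open>a + d\<close> are
  the odd multiples \<open>s + 1\<close> and \<open>2 * s + 1\<close> of \<open>g\<close>, and
  \<open>L g\<close> divides \<open>gcd (L a) (L (a + d))\<close>.\<close>

lemma lucas_complete_intersection_gcd:
  assumes "0 < a" "0 < d" "3 \<le> n" "int (gcd a d) = int a - int d"
    "multiplicity 2 a < multiplicity 2 d" "1 \<le> multiplicity 2 a"
  shows "toric_complete_intersection n (toric_ideal n (\<lambda>i. L (a + (i - 1) * d)) :: 'k::field mpoly set)"
proof (rule toric_complete_intersection_lucasI[OF assms(3)])
  fix i :: nat assume i: "2 \<le> i"
  define g where "g = gcd a d"
  have "even a" using assms(6) not_dvd_imp_multiplicity_0[of 2 a] by auto
  have "even d" using assms(5) not_dvd_imp_multiplicity_0[of 2 d] by auto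
  have g: "even g" "0 < g" using \<open>even a\<close> \<open>even d\<close> assms(1) by (simp_all add: g_def)
  have a: "a = d + g" using assms(4) unfolding g_def by linarith
  obtain s where s: "d = g * s" using gcd_dvd2[of a d] unfolding g_def[symmetric] ..
  have "even s"
  proof (rule ccontr)
    assume "odd s"
    then have "s > 0" by (cases s) auto
    have "multiplicity 2 d = multiplicity 2 g"
      unfolding s using g \<open>s > 0\<close> \<open>odd s\<close>
      by (simp add: prime_elem_multiplicity_mult_distrib not_dvd_imp_multiplicity_0)
    moreover have "multiplicity 2 g \<le> multiplicity 2 a"
      unfolding g_def using assms(1) by (intro dvd_imp_multiplicity_le) auto
    ultimately show False using assms(5) by simp
  qed
  have "a = g * (s + 1)" "a + d = g * (2 * s + 1)" using a s by (simp_all add: algebra_simps)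
  moreover have "L g dvd L (g * (s + 1))" "L g dvd L (g * (2 * s + 1))"
    using \<open>even s\<close> by (intro lucas_dvd_odd_mult; simp)+
  ultimately have "L g dvd L a" "L g dvd L (a + d)" by (simp_all only:)
  then have "L g dvd gcd (L a) (L (a + d))" by simp
  then have "L g \<le> gcd (L a) (L (a + d))" using lucas_pos[of a] by (intro dvd_imp_le) auto
  have "2 * d \<le> i * d" using i by (rule mult_le_mono1)
  then have "L a * L (a + d) \<le> L g * L (a + i * d)"
    by (intro lucas_mult_le_mult[OF g a _ assms(2)]) simp
  also have "\<dots> \<le> gcd (L a) (L (a + d)) * L (a + i * d)"
    by (rule mult_le_mono1) fact
  finally show "\<exists>u v. L (a + i * d) = u * L a + v * L (a + d)"
    by (intro nat_combination_exists gcd_dvd_lucas_progression \<open>even d\<close> lucas_pos)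
qed

lemma lucas_complete_intersection_three:
  assumes "0 < a" "0 < d" "even d" "d dvd a" "odd (a div d)" "odd p" "even q \<or> \<not> 3 dvd d"
  shows "toric_complete_intersection 3 (toric_ideal 3 (\<lambda>i. L (a + (i - 1) * d)) :: 'k::field mpoly set)"
proof -
  define k where "k = a div d"
  have k: "a = d * k" "odd k" using assms(4,5) by (simp_all add: k_def)
  \<comment> \<open>A gcd of at most 2 is 1 because \<open>L d\<close> is odd. The other alternative
    would make \<open>s = r * (k + 1)\<close> odd, although \<open>k\<close> is odd.\<close>
  have "coprime (L d) (L (a + d))"
  proof (cases rule: gcd_lucas_cases[of d "a + d"])
    case 1
    have "odd (L d)"
      using lucas_odd[of d] lucas_even_iff[of d] assms by (cases "even q") auto
    then have "gcd (L d) (L (a + d)) \<noteq> 2" by (metis gcd_dvd1)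
    moreover have "gcd (L d) (L (a + d)) \<noteq> 0" using lucas_pos[of d] by simp
    ultimately have "gcd (L d) (L (a + d)) = 1" using 1(1) by linarith
    then show ?thesis by (simp only: coprime_iff_gcd_eq_1)
  next
    case (2 g r s)
    have "g > 0" using 2 assms by (cases g) auto
    have "g * s = g * (r * (k + 1))" using 2(1,2) k(1) by (simp add: algebra_simps)
    then have "s = r * (k + 1)" using \<open>g > 0\<close> by simp
    then show ?thesis using k(2) 2(4) by simp
  qed
  moreover have "L d dvd L a" unfolding k(1) by (rule lucas_dvd_odd_mult[OF k(2)])
  moreover have "L d dvd L (a + 2 * d)"
  proof -
    have "L d dvd L (d * (k + 2))" by (rule lucas_dvd_odd_mult) (simp add: k(2))
    moreover have "d * (k + 2) = a + 2 * d" using k(1) by (simp add: algebra_simps)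
    ultimately show ?thesis by (simp only:)
  qed
  moreover have "L d * L (a + d) = q ^ d * L a + 1 * L (a + 2 * d)"
    using lucas_step_even[OF assms(3), of a 0] by (simp add: mult_2)
  ultimately show ?thesis
    using lucas_pos by (intro toric_complete_intersection_if_gluing[where t = "L d" and r = "q ^ d" and s = 1]) simp_all
qed

lemma lucas_not_complete_intersection:
  assumes "0 < d" "even d" "d < a" "3 \<le> n"
    and not_gcd: "\<not> (int (gcd a d) = int a - int d \<and> multiplicity 2 d > multiplicity 2 a \<and> multiplicity 2 a \<ge> 1)"
    and not_three: "\<not> (n = 3 \<and> odd p \<and> d dvd a \<and> odd (a div d) \<and> (even q \<or> \<not> 3 dvd d))"
  shows "\<not> toric_complete_intersection n (toric_ideal n (\<lambda>i. L (a + (i - 1) * d)) :: 'k::field mpoly set)"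
proof
  define D where "D i = L (a + (i - 1) * d)" for i
  have D: "D 1 = L a" "D 2 = L (a + d)" "D 3 = L (a + 2 * d)" by (simp_all add: D_def)
  have D_pos: "0 < D i" for i by (simp add: D_def lucas_pos)
  have step: "L d * D (i + 1) = D (i + 2) + q ^ d * D i" if "1 \<le> i" for i
    using lucas_step_even[OF assms(2), of a "i - 1"] that by (simp add: D_def)
  assume "toric_complete_intersection n (toric_ideal n (\<lambda>i. L (a + (i - 1) * d)) :: 'k mpoly set)"
  then have "toric_complete_intersection n (toric_ideal n D :: 'k mpoly set)"
    by (simp only: D_def[abs_def])
  then obtain i j mi mj where ij: "1 \<le> i" "i < j" "j \<le> n" "0 < mi" "0 < mj" "mi * D i = mj * D j"
    and mi: "\<And>k u. 0 < k \<Longrightarrow> Poly_Mapping.keys u \<subseteq> {1..n} - {i} \<Longrightarrow> wdeg D u = k * D i \<Longrightarrow> mi \<le> k"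
    and mj: "\<And>k u. 0 < k \<Longrightarrow> Poly_Mapping.keys u \<subseteq> {1..n} - {j} \<Longrightarrow> wdeg D u = k * D j \<Longrightarrow> mj \<le> k"
    by (rule toric_complete_intersection_equal_degrees)
      (use assms(4) D_pos in simp, use assms(4) D_pos in simp, rule that)
  have Dj_le: "D j \<le> mi * gcd (D i) (D j)"
  proof -
    have "D j dvd mi * D i" using ij by simp
    then have "D j dvd gcd (mi * D i) (mi * D j)" by simp
    then have "D j dvd mi * gcd (D i) (D j)" by (simp add: gcd_mult_distrib_nat)
    then show ?thesis using ij D_pos by (intro dvd_imp_le) auto
  qed
  have Di_le: "D i \<le> mj * gcd (D i) (D j)"
  proof -
    have "D i dvd mj * D j" using ij(6)[symmetric] by simp
    then have "D i dvd gcd (mj * D i) (mj * D j)" by simp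
    then have "D i dvd mj * gcd (D i) (D j)" by (simp add: gcd_mult_distrib_nat)
    then show ?thesis using ij D_pos by (intro dvd_imp_le) auto
  qed
  \<comment> \<open>The three-term relation represents \<open>L d * D k\<close> by the neighbours of
    an interior index \<open>k\<close>, so \<open>L d\<close> bounds its minimal multiplier.\<close>
  have middle: "Poly_Mapping.keys (Poly_Mapping.single (k - 1) (q ^ d) + Poly_Mapping.single (k + 1) 1) \<subseteq> {1..n} - {k}"
      "wdeg D (Poly_Mapping.single (k - 1) (q ^ d) + Poly_Mapping.single (k + 1) 1) = L d * D k"
    if "2 \<le> k" "k < n" for k
  proof -
    show "Poly_Mapping.keys (Poly_Mapping.single (k - 1) (q ^ d) + Poly_Mapping.single (k + 1) 1) \<subseteq> {1..n} - {k}"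
      using that by (intro keys_add_subset keys_single_subset) auto
    have "k - 1 + 1 = k" "k - 1 + 2 = k + 1" "1 \<le> k - 1" using that by simp_all
    then show "wdeg D (Poly_Mapping.single (k - 1) (q ^ d) + Poly_Mapping.single (k + 1) 1) = L d * D k"
      using step[of "k - 1"] by (simp add: wdeg_add)
  qed
  show False
  proof (cases "i = 1")
    case False
    \<comment> \<open>An interior index has \<open>mi \<le> L d\<close>, while
      \<open>j \<ge> 3\<close> and \<open>d < a\<close> put the index of \<open>D j\<close> above
      \<open>3 * d\<close>.\<close>
    then have i: "2 \<le> i" "i < n" using ij by linarith+
    have "mi \<le> L d" using mi[OF lucas_pos middle[OF i]] .
    define s t where "s = a + (i - 1) * d" and "t = a + (j - 1) * d"
    have "1 * d \<le> (i - 1) * d" "2 * d \<le> (j - 1) * d" using i ij by (intro mult_le_mono1; linarith)+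
    moreover have "(i - 1) * d < (j - 1) * d"
      using i ij assms(1) by (intro mult_strict_right_mono) linarith+
    ultimately have "0 < s" "s < t" "3 * d < t" using assms(1,3) unfolding s_def t_def by linarith+
    then have "L d * gcd (L s) (L t) < L t" by (rule lucas_mult_gcd_less[OF assms(2,1)])
    also have "L t \<le> mi * gcd (L s) (L t)" using Dj_le unfolding D_def s_def t_def .
    also have "\<dots> \<le> L d * gcd (L s) (L t)" using \<open>mi \<le> L d\<close> by (rule mult_le_mono1)
    finally show False by simp
  next
    case True
    define G where "G = gcd (D 1) (D 2)"
    have "G > 0" using D_pos by (simp add: G_def)
    \<comment> \<open>Subtracting \<open>L d * D 2 = D 3 + q ^ d * D 1\<close> from the trivial relation \<open>x * D 2 = y * D 1\<close>
      yields a relation with a smaller coefficient of \<open>D 1\<close>.\<close>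
    obtain x where x: "D 1 = G * x"
      using gcd_dvd1[of "D 1" "D 2"] unfolding G_def[symmetric] ..
    obtain y where y: "D 2 = G * y"
      using gcd_dvd2[of "D 1" "D 2"] unfolding G_def[symmetric] ..
    note xy = x y
    have "L d * G \<le> D 1"
      unfolding G_def D by (rule lucas_mult_gcd_le[OF assms(2,1,3) not_gcd])
    then have "L d \<le> x" using \<open>G > 0\<close> xy(1) by (simp add: mult.commute)
    then obtain z where z: "x = L d + z" using le_Suc_ex by blast
    have "G * (x * D 2) = G * (y * D 1)" using xy by (simp add: ac_simps)
    then have "x * D 2 = y * D 1" using \<open>G > 0\<close> by simp
    then have eq: "D 3 + q ^ d * D 1 + z * D 2 = y * D 1"
      using step[of 1] unfolding z by (simp add: algebra_simps numeral_3_eq_3 numeral_2_eq_2)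
    have "q ^ d < y"
    proof (rule ccontr)
      assume "\<not> q ^ d < y"
      then have "y * D 1 \<le> q ^ d * D 1" by (intro mult_le_mono1) simp
      then show False using eq D_pos[of 3] by linarith
    qed
    then have w: "wdeg D (Poly_Mapping.single 2 z + Poly_Mapping.single 3 1) = (y - q ^ d) * D 1"
      using eq by (simp add: wdeg_add diff_mult_distrib)
    have "mi \<le> y - q ^ d"
    proof (rule mi)
      show "0 < y - q ^ d" using \<open>q ^ d < y\<close> by simp
      show "wdeg D (Poly_Mapping.single 2 z + Poly_Mapping.single 3 1) = (y - q ^ d) * D i"
        using w True by simp
      show "Poly_Mapping.keys (Poly_Mapping.single 2 z + Poly_Mapping.single 3 1) \<subseteq> {1..n} - {i}"
        using True assms(4) by (intro keys_add_subset keys_single_subset) auto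
    qed
    moreover have "0 < q ^ d" using q by simp
    ultimately have "mi < y" using \<open>q ^ d < y\<close> by linarith
    then have mG: "mi * G < D 2" using xy(2) \<open>G > 0\<close> by (simp add: mult.commute)
    have "j \<noteq> 2" using Dj_le mG True by (auto simp: G_def)
    then have j: "2 \<le> j - 1" using ij True by linarith
    have "mi < D 2"
    proof -
      have "mi * 1 \<le> mi * G" using \<open>G > 0\<close> by (intro mult_le_mono2) simp
      then show ?thesis using mG by linarith
    qed
    have Dj: "D j = L (a + (j - 1) * d)" by (simp add: D_def)
    show False
    proof (cases rule: gcd_lucas_mult_le[OF assms(2,1,3) j])
      case 1
      have "D j \<le> mi * gcd (D 1) (D j)" using Dj_le True by simp
      also have "\<dots> < D 2 * gcd (D 1) (D j)" using \<open>mi < D 2\<close> D_pos by simp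
      also have "\<dots> \<le> D j" using 1 unfolding D Dj by (simp add: mult.commute)
      finally show False by simp
    next
      case 2
      \<comment> \<open>The exceptional case, in which only \<open>D 3 \<le> mi * L d\<close> is
        available for \<open>j\<close>.\<close>
      have "j = 3" using 2 j by linarith
      have gcd: "gcd (D i) (D j) = L d" unfolding True D Dj by (rule 2(4))
      define k where "k = a div d"
      have k: "a = d * k" "odd k" using 2(2,3) by (simp_all add: k_def)
      show False
      proof (cases "n = 3")
        case False
        \<comment> \<open>For \<open>n > 3\<close> index 3 is interior, so also
          \<open>mj \<le> L d\<close> and \<open>D 1 \<le> L d * L d\<close>, whereas
          \<open>a \<ge> 3 * d\<close>.\<close>
        then have "j < n" using \<open>j = 3\<close> assms(4) by simp
        have "mj \<le> L d" using mj[OF lucas_pos middle[of j]] \<open>j < n\<close> \<open>j = 3\<close> by simp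
        have "k \<noteq> 1" using k(1) assms(3) by auto
        then have "3 \<le> k" using k(2) by (auto elim!: oddE)
        then have "d * 3 \<le> a" unfolding k(1) by (rule mult_le_mono2)
        then have "L (3 * d) \<le> L a" using assms(1) by (intro lucas_le) auto
        also have "\<dots> \<le> mj * L d" using Di_le unfolding gcd unfolding True D .
        also have "\<dots> \<le> L d * L d" using \<open>mj \<le> L d\<close> by (rule mult_le_mono1)
        also have "\<dots> < L (3 * d)" by (rule lucas_square_less[OF assms(2,1)])
        finally show False by simp
      next
        case True
        \<comment> \<open>For \<open>n = 3\<close> the excluded cases leave \<open>D 1\<close> and
          \<open>D 2\<close> both even, so \<open>G \<ge> 2\<close> halves the bound on
          \<open>mi\<close>.\<close>
        then have "even p \<or> odd q \<and> 3 dvd d" using not_three 2 by blast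
        then have "even (L a) \<and> even (L (a + d))"
          using lucas_even lucas_even_iff k(1) by (cases "even p") auto
        then have "2 dvd G" unfolding G_def D by simp
        then have "2 \<le> G" using \<open>G > 0\<close> by (rule dvd_imp_le)
        then have "mi * 2 \<le> mi * G" by (rule mult_le_mono2)
        then have "mi * 2 < D 2" using mG by linarith
        then have "2 * (mi * L d) < L d * D 2" using lucas_pos[of d] by (simp add: ac_simps)
        also have "\<dots> = D 3 + q ^ d * D 1" using step[of 1] by (simp add: numeral_3_eq_3 numeral_2_eq_2)
        also have "q ^ d * D 1 \<le> D 3" unfolding D by (rule lucas_power_le)
        finally have "2 * (mi * L d) < D 3 + D 3" by simp
        moreover have "D 3 \<le> mi * L d" using Dj_le unfolding gcd unfolding \<open>j = 3\<close> .
        ultimately show False by linarith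
      qed
    qed
  qed
qed

end
end

theorem theorem5p1:
  fixes p q a d n :: nat
  assumes "p > 0" and "q > 0" and "coprime p q"
    and "a > 0" and "d > 0" and "n \<ge> 3"
  shows "toric_complete_intersection n
      (toric_ideal n (\<lambda>i. lucas p q (a + (i - 1) * d)) :: 'k::field mpoly set) \<longleftrightarrow>
    odd d \<or>
    d \<ge> a \<or>
    (int (gcd a d) = int a - int d \<and>
      multiplicity 2 d > multiplicity 2 a \<and> multiplicity 2 a \<ge> 1) \<or>
    (n = 3 \<and> odd p \<and> (d dvd a \<and> odd (a div d)) \<and> even q) \<or>
    (n = 3 \<and> \<not> 3 dvd d \<and> odd p \<and> odd q \<and> (d dvd a \<and> odd (a div d)))"
    (is "?ci \<longleftrightarrow> ?a \<or> ?b \<or> ?c \<or> ?d \<or> ?e")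
proof
  assume ci: ?ci
  show "?a \<or> ?b \<or> ?c \<or> ?d \<or> ?e"
  proof (rule ccontr)
    assume none: "\<not> (?a \<or> ?b \<or> ?c \<or> ?d \<or> ?e)"
    have "\<not> ?ci"
    proof (rule lucas_not_complete_intersection[OF assms(1,2,3,5)])
      show "even d" "d < a" "3 \<le> n" using none assms(6) by auto
      show "\<not> ?c" using none by blast
      show "\<not> (n = 3 \<and> odd p \<and> d dvd a \<and> odd (a div d) \<and> (even q \<or> \<not> 3 dvd d))" using none by blast
    qed
    then show False using ci by contradiction
  qed
next
  assume cases: "?a \<or> ?b \<or> ?c \<or> ?d \<or> ?e"
  show ?ci
  proof (cases "odd d")
    case True
    then show ?thesis
      by (intro toric_complete_intersection_lucasI[OF assms(1,2,3,6)] lucas_progression_odd[OF assms(1,2,3)])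
  next
    case False
    \<comment> \<open>The cases (d) and (e) together say that \<open>q\<close> is even or 3 does not
      divide \<open>d\<close>.\<close>
    consider ?b | ?c | "n = 3" "d dvd a" "odd (a div d)" "odd p" "even q \<or> \<not> 3 dvd d"
      using cases False by blast
    then show ?thesis
    proof cases
      case 1
      show ?thesis by (rule lucas_complete_intersection_le[OF assms(1-5) _ 1 assms(6)]) (use False in simp)
    next
      case 2
      then show ?thesis by (intro lucas_complete_intersection_gcd[OF assms(1-6)]) auto
    next
      case 3
      show ?thesis unfolding \<open>n = 3\<close>
        by (rule lucas_complete_intersection_three[OF assms(1-5) _ 3(2-5)]) (use False in simp)
    qed
  qed
qed

end
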